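(* Let $C$ be the non-complete intersection Gorenstein monomial curve $x_i=t^{n_i}$ ($1\le i\le4$) in $\mathbb{A}^4(K)$, with $n_1<n_2<n_3<n_4$. Suppose that $I(C)$ is given as in case 1(a), i.e. $I(C)$ is minimally generated by $$f_1=x_1^{a_1}-x_3^{a_{13}}x_4^{a_{14}},\quad f_2=x_2^{a_2}-x_1^{a_{21}}x_4^{a_{24}},\quad f_3=x_3^{a_3}-x_1^{a_{31}}x_2^{a_{32}},$$ $$f_4=x_4^{a_4}-x_2^{a_{42}}x_3^{a_{43}},\quad f_5=x_1^{a_{21}}x_3^{a_{43}}-x_2^{a_{32}}x_4^{a_{14}}.$$ Then $C$ has Cohen-Macaulay tangent cone at the origin if and only if $a_2\le a_{21}+a_{24}$.
   Context: $K$ is a field and $n_1,\dots,n_4$ are positive integers with $\gcd(n_1,\dots,n_4)=1$. $I(C)$ is the kernel of the $K$-algebra homomorphism $K[x_1,\dots,x_4]\to K[t]$, $x_i\mapsto t^{n_i}$. $C$ is Gorenstein if the semigroup $\mathcal{S}=\{g_1n_1+\cdots+g_4n_4: g_i\in\mathbb{N}\}$ is symmetric ($\mathbb{N}$ = non-negative integers). In the description of $I(C)$, all exponents are integers with $0<a_{ij}<a_j$, and (by Bresinsky) $a_1=a_{21}+a_{31}$, $a_2=a_{32}+a_{42}$, $a_3=a_{13}+a_{43}$, $a_4=a_{14}+a_{24}$. $C$ has Cohen-Macaulay tangent cone at the origin if the ring $K[x_1,\dots,x_4]/I(C)_*$ is Cohen-Macaulay, where $I(C)_*$ is generated by the homogeneous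 (standard grading) summands $f_*$ of least degree of the polynomials $f\in I(C)$. *)

theory Defs
  imports
    "HOL-Algebra.Algebraic_Closure_Type"
    "HOL-Library.Poly_Mapping"
    "HOL-Library.Numeral_Type"
    "HOL-Library.Extended_Nat"
    "HOL-Computational_Algebra.Polynomial"
begin

section \<open>Cohen-Macaulay rings\<close>

text \<open>
  Codimension (height) of a prime ideal \<open>P\<close>: the supremum of the lengths \<open>k\<close> of chains of
  prime ideals \<open>C 0 \<subset> C 1 \<subset> \<dots> \<subset> C k = P\<close>.
\<close>

definition height :: "('a, 'b) ring_scheme \<Rightarrow> 'a set \<Rightarrow> enat" where
  "height R P = Sup {enat k | k.
     \<exists>C :: nat \<Rightarrow> 'a set. C k = P \<and> (\<forall>i\<le>k. primeideal (C i) R) \<and> (\<forall>i<k. C i \<subset> C (Suc i))}"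

text \<open>
  \<open>xs ! i\<close> has to be a nonzerodivisor modulo the preceding elements, and the quotient by
  all of \<open>xs\<close> must not vanish.
\<close>

definition regular_sequence :: "('a, 'b) ring_scheme \<Rightarrow> 'a list \<Rightarrow> bool" where
  "regular_sequence R xs \<longleftrightarrow>
     set xs \<subseteq> carrier R \<and>
     (\<forall>i<length xs. \<forall>r\<in>carrier R.
        xs ! i \<otimes>\<^bsub>R\<^esub> r \<in> genideal R (set (take i xs)) \<longrightarrow> r \<in> genideal R (set (take i xs))) \<and>
     genideal R (set xs) \<noteq> carrier R"

definition depth :: "('a, 'b) ring_scheme \<Rightarrow> 'a set \<Rightarrow> enat" where
  "depth R P = Sup {enat (length xs) | xs. regular_sequence R xs \<and> set xs \<subseteq> P}"

text \<open>
  The localisation-free definition of Eisenbud, \<^emph>\<open>Commutative Algebra\<close>, Section 18.2: a Noetherian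
  ring is Cohen-Macaulay if depth and codimension agree for every maximal ideal.
\<close>

definition cohen_macaulay :: "('a, 'b) ring_scheme \<Rightarrow> bool" where
  "cohen_macaulay R \<longleftrightarrow>
     cring R \<and> noetherian_ring R \<and> (\<forall>P. maximalideal P R \<longrightarrow> depth R P = height R P)"

section \<open>Generators and complete intersections\<close>

definition minimally_generates :: "('a, 'b) ring_scheme \<Rightarrow> 'a set \<Rightarrow> 'a set \<Rightarrow> bool" where
  "minimally_generates R F I \<longleftrightarrow>
     F \<subseteq> carrier R \<and> genideal R F = I \<and> (\<forall>G. G \<subset> F \<longrightarrow> genideal R G \<noteq> I)"

text \<open>To be used for prime ideals \<open>P\<close> only, since \<open>height\<close> is.\<close>

definition complete_intersection :: "('a, 'b) ring_scheme \<Rightarrow> 'a set \<Rightarrow> bool" where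
  "complete_intersection R P \<longleftrightarrow>
     (\<exists>F. finite F \<and> F \<subseteq> carrier R \<and> enat (card F) = height R P \<and> genideal R F = P)"

section \<open>Polynomials and leading forms at the origin\<close>

text \<open>
  A polynomial over \<open>'k\<close> in the variables \<open>'v\<close> maps each exponent vector to its coefficient.
\<close>

type_synonym ('v, 'k) mpoly = "('v \<Rightarrow>\<^sub>0 nat) \<Rightarrow>\<^sub>0 'k"

definition Var :: "'v \<Rightarrow> ('v, 'k::comm_ring_1) mpoly" where
  "Var i = Poly_Mapping.single (Poly_Mapping.single i 1) 1"

definition mdegree :: "('v::finite \<Rightarrow>\<^sub>0 nat) \<Rightarrow> nat" where
  "mdegree m = (\<Sum>i\<in>UNIV. Poly_Mapping.lookup m i)"

definition homogeneous_component :: "nat \<Rightarrow> ('v::finite, 'k::comm_ring_1) mpoly \<Rightarrow> ('v, 'k) mpoly"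
  where "homogeneous_component d f =
    (\<Sum>m\<in>{m \<in> Poly_Mapping.keys f. mdegree m = d}.
       Poly_Mapping.single m (Poly_Mapping.lookup f m))"

text \<open>The value at \<open>f = 0\<close> is \<open>0\<close>.\<close>

definition initial_form :: "('v::finite, 'k::comm_ring_1) mpoly \<Rightarrow> ('v, 'k) mpoly" where
  "initial_form f = homogeneous_component (LEAST d. \<exists>m\<in>Poly_Mapping.keys f. mdegree m = d) f"

definition initial_ideal :: "('v::finite, 'k::comm_ring_1) mpoly set \<Rightarrow> ('v, 'k) mpoly set" where
  "initial_ideal I = genideal ring_of_type_algebra (initial_form ` I)"

section \<open>Monomial curves\<close>

text \<open>
  The curve with parametrisation \<open>x\<^sub>i = t ^ n i\<close>: \<open>curve_hom n\<close> is the homomorphism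
  \<open>x\<^sub>i \<mapsto> t ^ n i\<close> into univariate polynomials. For curves in affine 4-space the index type is
  \<open>4\<close>, whose elements are \<open>1, 2, 3, 4\<close>, with \<open>4 = 0\<close> there.
\<close>

definition curve_hom :: "('v::finite \<Rightarrow> nat) \<Rightarrow> ('v, 'k::comm_ring_1) mpoly \<Rightarrow> 'k poly" where
  "curve_hom n f =
     (\<Sum>m\<in>Poly_Mapping.keys f. Polynomial.smult (Poly_Mapping.lookup f m)
       (\<Prod>i\<in>UNIV. Polynomial.monom 1 (n i) ^ Poly_Mapping.lookup m i))"

definition curve_ideal :: "('v::finite \<Rightarrow> nat) \<Rightarrow> ('v, 'k::comm_ring_1) mpoly set" where
  "curve_ideal n = {f. curve_hom n f = 0}"

definition cm_tangent_cone :: "'k::field itself \<Rightarrow> ('v::finite \<Rightarrow> nat) \<Rightarrow> bool" where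
  "cm_tangent_cone _ n \<longleftrightarrow>
     cohen_macaulay
       ((ring_of_type_algebra :: ('v, 'k) mpoly ring) Quot initial_ideal (curve_ideal n))"

definition curve_semigroup :: "('v::finite \<Rightarrow> nat) \<Rightarrow> nat set" where
  "curve_semigroup n = {\<Sum>i\<in>UNIV. g i * n i | g. True}"

text \<open>
  \<open>F\<close> is the Frobenius number, i.e. the largest integer outside \<open>S\<close>; it is \<open>-1\<close> if \<open>S = UNIV\<close>.
\<close>

definition symmetric_semigroup :: "nat set \<Rightarrow> bool" where
  "symmetric_semigroup S \<longleftrightarrow>
     (\<exists>F::int. F \<notin> int ` S \<and> (\<forall>z>F. z \<in> int ` S) \<and> (\<forall>z. z \<in> int ` S \<longleftrightarrow> F - z \<notin> int ` S))"

definition gorenstein_curve :: "('v::finite \<Rightarrow> nat) \<Rightarrow> bool" where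
  "gorenstein_curve n \<longleftrightarrow> symmetric_semigroup (curve_semigroup n)"

end

theory Submission
  imports Defs "HOL-Analysis.Cartesian_Space"
begin

text \<open>
  Let \<open>J\<close> be the ideal of initial forms of the curve and \<open>A = K[x\<^sub>1, \<dots>, x\<^sub>4] / J\<close>.

  \<^emph>\<open>The ring.\<close> For \<open>i \<noteq> 1\<close> the polynomial \<open>x\<^sub>i ^ n\<^sub>1 - x\<^sub>1 ^ n\<^sub>i\<close> lies in the curve ideal and has the
  initial form \<open>x\<^sub>i ^ n\<^sub>1\<close>, because \<open>n\<^sub>1\<close> is the smallest weight; so \<open>x\<^sub>i\<close> is nilpotent in \<open>A\<close>, whereas
  no nonzero polynomial in \<open>x\<^sub>1\<close> is. Hence the prime ideals of \<open>A\<close> are those of \<open>K[x\<^sub>1]\<close>: every maximal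
  ideal has height one, and \<open>A\<close> is Cohen-Macaulay if and only if every maximal ideal contains a
  nonzerodivisor (\<open>cohen_macaulayI\<close>, \<open>cohen_macaulayD\<close>). This happens exactly if \<open>x\<^sub>1\<close> is a
  nonzerodivisor.

  \<^emph>\<open>The ideal.\<close> Give \<open>x\<^sub>i\<close> the weight \<open>n\<^sub>i\<close>. A monomial is nonzero in \<open>A\<close> exactly if its degree is
  maximal among the monomials of its weight, and two such monomials of equal weight agree in \<open>A\<close>
  (\<open>initial_ideal_curve_ideal\<close>). Therefore \<open>x\<^sub>1\<close> is a nonzerodivisor if and only if multiplication by
  \<open>x\<^sub>1\<close> preserves maximality of the degree (\<open>cm_tangent_cone_iff\<close>).

  \<^emph>\<open>The monomials.\<close> If \<open>a\<^sub>2 > a\<^sub>2\<^sub>1 + a\<^sub>2\<^sub>4\<close>, then \<open>f\<^sub>2\<close> shows that \<open>x\<^sub>1 ^ a\<^sub>2\<^sub>1 * x\<^sub>4 ^ a\<^sub>2\<^sub>4\<close> does not have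
  maximal degree, but \<open>x\<^sub>4 ^ a\<^sub>2\<^sub>4\<close> is divisible by no monomial of a generator, hence it is the only
  monomial of its weight; so \<open>x\<^sub>1\<close> is a zero divisor. If \<open>a\<^sub>2 \<le> a\<^sub>2\<^sub>1 + a\<^sub>2\<^sub>4\<close>, read the generators as
  moves that replace a monomial free of \<open>x\<^sub>1\<close>:
  \<open>x\<^sub>3 ^ a\<^sub>1\<^sub>3 * x\<^sub>4 ^ a\<^sub>1\<^sub>4\<close>, \<open>x\<^sub>2 ^ a\<^sub>2\<close>, \<open>x\<^sub>3 ^ a\<^sub>3\<close>, \<open>x\<^sub>4 ^ a\<^sub>4\<close> and \<open>x\<^sub>2 ^ a\<^sub>3\<^sub>2 * x\<^sub>4 ^ a\<^sub>1\<^sub>4\<close>. No move lowers the degree: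
  for \<open>f\<^sub>1\<close>, \<open>f\<^sub>3\<close> and \<open>f\<^sub>4\<close> this follows from the order of the weights, for \<open>f\<^sub>2\<close> it is the assumption,
  and for \<open>f\<^sub>5\<close> it follows by adding the inequalities for \<open>f\<^sub>2\<close> and \<open>f\<^sub>4\<close>. The moves are confluent
  (\<open>step_locally_confluent\<close>) and terminate, and since the binomials generate the curve ideal, they connect
  any two monomials of equal weight (\<open>binomial_generators_connect\<close>). So all monomials of a given weight
  reach the same normal form, which thus has maximal degree. Since the moves never need a factor \<open>x\<^sub>1\<close>, the product
  of \<open>x\<^sub>1\<close> with a normal form is a normal form, and so \<open>x\<^sub>1\<close> preserves maximality.
\<close>

section \<open>Depth and height of prime ideals\<close>

lemma le_heightI:
  fixes C :: "nat \<Rightarrow> 'a set"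
  assumes "C k = P" "\<forall>j\<le>k. primeideal (C j) R" "\<forall>j<k. C j \<subset> C (Suc j)"
  shows "enat k \<le> height R P"
  unfolding height_def using assms by (intro Sup_upper) blast

text \<open>
  An ideal that is maximal among those disjoint from a multiplicative set \<open>S\<close> is prime: if neither
  \<open>a\<close> nor \<open>b\<close> belongs to it, then adding \<open>a\<close>, and likewise \<open>b\<close>, produces an element of \<open>S\<close>, and the
  product of the two elements lies in the ideal if \<open>a \<otimes> b\<close> does. Maximality is part of the conclusion
  because for \<open>S = {\<one>}\<close> it makes the prime a maximal ideal.
\<close>

lemma (in cring) exists_prime_avoiding:
  assumes I: "ideal I R" and S: "S \<subseteq> carrier R" "\<one> \<in> S" "\<And>s t. s \<in> S \<Longrightarrow> t \<in> S \<Longrightarrow> s \<otimes> t \<in> S"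
    and disj: "I \<inter> S = {}"
  obtains Q where "primeideal Q R" "I \<subseteq> Q" "Q \<inter> S = {}"
    "\<And>J. ideal J R \<Longrightarrow> Q \<subseteq> J \<Longrightarrow> J \<inter> S = {} \<Longrightarrow> J = Q"
proof -
  define F where "F = {J. ideal J R \<and> I \<subseteq> J \<and> J \<inter> S = {}}"
  have "\<exists>M\<in>F. \<forall>J\<in>F. M \<subseteq> J \<longrightarrow> J = M"
  proof (rule subset_Zorn_nonempty)
    show "F \<noteq> {}" using I disj by (auto simp: F_def)
    fix C assume C: "C \<noteq> {}" "subset.chain F C"
    have "subset.chain {J. ideal J R} C" using C(2) by (auto simp: F_def pred_on.chain_def)
    then have "ideal (\<Union>C) R" using chain_Union_is_ideal[of C] C(1) by simp
    then show "\<Union>C \<in> F" using C by (auto simp: F_def pred_on.chain_def)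
  qed
  then obtain Q where Q: "ideal Q R" "I \<subseteq> Q" "Q \<inter> S = {}"
    and mx: "\<And>J. ideal J R \<Longrightarrow> Q \<subseteq> J \<Longrightarrow> J \<inter> S = {} \<Longrightarrow> J = Q"
    unfolding F_def by (smt (verit, best) mem_Collect_eq order_trans)
  interpret Q: ideal Q R by fact
  have hit: "\<exists>q\<in>Q. \<exists>r\<in>carrier R. q \<oplus> r \<otimes> a \<in> S" if a: "a \<in> carrier R" "a \<notin> Q" for a
  proof -
    have id: "ideal (Q <+> PIdl a) R" using add_ideals[OF Q(1) cgenideal_ideal[OF a(1)]] .
    have sub: "Q \<subseteq> Q <+> PIdl a"
    proof
      fix q assume q: "q \<in> Q"
      have "q = q \<oplus> \<zero> \<otimes> a" using q a Q.Icarr by simp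
      then show "q \<in> Q <+> PIdl a" unfolding set_add_def' cgenideal_def using q by blast
    qed
    have "a = \<zero> \<oplus> \<one> \<otimes> a" using a by simp
    then have "a \<in> Q <+> PIdl a" unfolding set_add_def' cgenideal_def
      using Q.zero_closed by blast
    then have "(Q <+> PIdl a) \<inter> S \<noteq> {}" using mx[OF id sub] a(2) by blast
    then show ?thesis unfolding set_add_def' cgenideal_def by blast
  qed
  have "primeideal Q R"
  proof (rule primeidealI[OF Q(1) is_cring])
    show "carrier R \<noteq> Q" using S(1,2) Q(3) by blast
    fix a b assume ab: "a \<in> carrier R" "b \<in> carrier R" "a \<otimes> b \<in> Q"
    show "a \<in> Q \<or> b \<in> Q"
    proof (rule ccontr)
      assume "\<not> (a \<in> Q \<or> b \<in> Q)"
      then obtain q r q' r' where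
        q: "q \<in> Q" "r \<in> carrier R" "q \<oplus> r \<otimes> a \<in> S" and
        q': "q' \<in> Q" "r' \<in> carrier R" "q' \<oplus> r' \<otimes> b \<in> S"
        using hit[of a] hit[of b] ab by blast
      have c: "q \<in> carrier R" "q' \<in> carrier R" using q q' Q.Icarr by auto
      have "(q \<oplus> r \<otimes> a) \<otimes> (q' \<oplus> r' \<otimes> b)
          = (q' \<oplus> r' \<otimes> b) \<otimes> q \<oplus> (r \<otimes> a) \<otimes> q' \<oplus> (r \<otimes> r') \<otimes> (a \<otimes> b)"
        using ab(1,2) c q(2) q'(2) by algebra
      moreover have "\<dots> \<in> Q"
        using ab(1,2) c q(2) q'(2) q'(3) S(1) by (intro Q.a_closed Q.I_l_closed ab(3) q(1) q'(1)) auto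
      ultimately show False using S(3)[OF q(3) q'(3)] Q(3) by auto
    qed
  qed
  with Q mx show thesis using that by blast
qed

text \<open>
  Descend along the sequence. Let \<open>a\<close> be the last element of the current initial segment, which is
  contained in \<open>Q\<close>, and \<open>I\<close> the ideal of the elements before it. Since \<open>a\<close> can be cancelled modulo \<open>I\<close>,
  no product of a power of \<open>a\<close> and an element outside \<open>Q\<close> lies in \<open>I\<close>. A prime above \<open>I\<close> that avoids all
  these products is contained in \<open>Q\<close> and misses \<open>a\<close>.
\<close>

lemma (in cring) regular_sequence_prime_chain:
  assumes reg: "regular_sequence R xs" and "i \<le> length xs" "primeideal Q R" "set (take i xs) \<subseteq> Q"
  shows "\<exists>C :: nat \<Rightarrow> 'a set. C i = Q \<and> (\<forall>j\<le>i. primeideal (C j) R) \<and> (\<forall>j<i. C j \<subset> C (Suc j))"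
  using assms(2-)
proof (induction i arbitrary: Q)
  case 0
  then show ?case by (intro exI[of _ "\<lambda>_. Q"]) auto
next
  case (Suc i)
  interpret Q: primeideal Q R by fact
  define I where "I = Idl (set (take i xs))"
  define a where "a = xs ! i"
  have i: "i < length xs" using Suc.prems by simp
  have take: "set (take (Suc i) xs) = insert a (set (take i xs))"
    using i by (simp add: take_Suc_conv_app_nth a_def)
  have xs: "set xs \<subseteq> carrier R" using reg by (simp add: regular_sequence_def)
  then have a: "a \<in> carrier R" using i by (auto simp: a_def)
  have tc: "set (take i xs) \<subseteq> carrier R" using xs set_take_subset[of i xs] by blast
  have idI: "ideal I R" unfolding I_def using tc by (rule genideal_ideal)
  have IQ: "I \<subseteq> Q" unfolding I_def
    using Suc.prems take by (intro genideal_minimal Q.is_ideal) auto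
  have cancel: "r \<in> I" if "r \<in> carrier R" "a \<otimes> r \<in> I" for r
    using reg that i by (auto simp: regular_sequence_def I_def a_def)
  \<comment> \<open>Inverting \<open>S\<close> amounts to localising at \<open>Q\<close> and then inverting \<open>a\<close>.\<close>
  define S where "S = {a [^] (j::nat) \<otimes> s | j s. s \<in> carrier R - Q}"
  have "I \<inter> S = {}"
  proof -
    have "a [^] (j::nat) \<otimes> s \<in> I \<Longrightarrow> s \<in> I" if s: "s \<in> carrier R" for j s
    proof (induction j)
      case (Suc j)
      have "a [^] Suc j \<otimes> s = a \<otimes> (a [^] j \<otimes> s)"
        using a s by (simp add: m_assoc m_comm[of "a [^] j" a])
      then have "a \<otimes> (a [^] j \<otimes> s) \<in> I" using Suc.prems by metis
      then show ?case using Suc.IH cancel[of "a [^] j \<otimes> s"] a s by blast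
    qed (use s in simp)
    then show ?thesis using IQ by (auto simp: S_def)
  qed
  moreover have "S \<subseteq> carrier R" using a by (auto simp: S_def)
  moreover have one: "\<one> \<notin> Q" using Q.one_imp_carrier Q.I_notcarr by blast
  then have "\<one> \<in> S" unfolding S_def by (intro CollectI exI[of _ 0] exI[of _ \<one>]) simp
  moreover have "s \<otimes> t \<in> S" if "s \<in> S" "t \<in> S" for s t
  proof -
    obtain j u l v where e: "s = a [^] (j::nat) \<otimes> u" "t = a [^] (l::nat) \<otimes> v"
      and uv: "u \<in> carrier R - Q" "v \<in> carrier R - Q" using \<open>s \<in> S\<close> \<open>t \<in> S\<close> unfolding S_def by blast
    have "s \<otimes> t = a [^] (j + l) \<otimes> (u \<otimes> v)"
      using a uv by (simp add: e nat_pow_mult[symmetric] m_ac)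
    moreover have "u \<otimes> v \<in> carrier R - Q" using uv Q.I_prime by auto
    ultimately show ?thesis unfolding S_def by blast
  qed
  ultimately obtain Q' where Q': "primeideal Q' R" "I \<subseteq> Q'" "Q' \<inter> S = {}"
    using exists_prime_avoiding[OF idI] by metis
  interpret Q': primeideal Q' R by fact
  have "Q' \<subseteq> Q"
  proof
    fix s assume s: "s \<in> Q'"
    show "s \<in> Q"
    proof (rule ccontr)
      assume "s \<notin> Q"
      then have "s \<in> S" unfolding S_def using s Q'.Icarr
        by (intro CollectI exI[of _ 0] exI[of _ s]) simp
      then show False using Q'(3) s by blast
    qed
  qed
  moreover have "a \<in> S" unfolding S_def using a one
    by (intro CollectI exI[of _ 1] exI[of _ \<one>]) (simp add: nat_pow_eone)
  moreover have "a \<in> Q" using Suc.prems take by simp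
  ultimately have sub: "Q' \<subset> Q" using Q'(3) by blast
  have "set (take i xs) \<subseteq> Q'" using genideal_self[OF tc] Q'(2) I_def by simp
  then obtain C where C: "C i = Q'" "\<forall>j\<le>i. primeideal (C j) R" "\<forall>j<i. C j \<subset> C (Suc j)"
    using Suc.IH[OF _ Q'(1)] Suc.prems by auto
  show ?case
  proof (intro exI[of _ "C(Suc i := Q)"] conjI allI impI)
    fix j assume "j \<le> Suc i"
    then show "primeideal ((C(Suc i := Q)) j) R" using C(2) Suc.prems(2) by (cases "j = Suc i") auto
  next
    fix j assume "j < Suc i"
    then show "(C(Suc i := Q)) j \<subset> (C(Suc i := Q)) (Suc j)" using C(1,3) sub by (cases "j = i") auto
  qed simp
qed

lemma (in cring) depth_le_height:
  assumes "primeideal P R"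
  shows "depth R P \<le> height R P"
  unfolding depth_def
proof (rule Sup_least, clarify)
  fix xs assume xs: "regular_sequence R xs" "set xs \<subseteq> P"
  obtain C where "C (length xs) = P" "\<forall>j\<le>length xs. primeideal (C j) R" "\<forall>j<length xs. C j \<subset> C (Suc j)"
    using regular_sequence_prime_chain[OF xs(1) order_refl assms] xs(2) by auto
  then show "enat (length xs) \<le> height R P" by (rule le_heightI)
qed

section \<open>Finite modules over a polynomial ring in one variable\<close>

lemma poly_ideal_principal:
  fixes L :: "'k::field poly set"
  assumes zero: "0 \<in> L" and add: "\<And>p q. p \<in> L \<Longrightarrow> q \<in> L \<Longrightarrow> p + q \<in> L"
    and mult: "\<And>p q. p \<in> L \<Longrightarrow> q * p \<in> L"
  obtains g where "L = {p. g dvd p}"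
proof (cases "L \<subseteq> {0}")
  case True
  then show thesis using zero that[of 0] by auto
next
  case False
  then obtain g where g: "g \<in> L" "g \<noteq> 0" and mn: "\<And>p. p \<in> L \<Longrightarrow> p \<noteq> 0 \<Longrightarrow> degree g \<le> degree p"
    using ex_has_least_nat[of "\<lambda>p. p \<in> L \<and> p \<noteq> 0" _ degree] by blast
  have "g dvd p" if p: "p \<in> L" for p
  proof -
    have "p mod g = p + (- (p div g)) * g" by (simp add: minus_div_mult_eq_mod[symmetric])
    then have "p mod g \<in> L" using add[OF p mult[OF g(1), of "- (p div g)"]] by simp
    then have "p mod g = 0" using mn[of "p mod g"] degree_mod_less[OF g(2), of p] by (meson not_le)
    then show ?thesis by (simp add: mod_eq_0_iff_dvd)
  qed
  moreover have "p \<in> L" if "g dvd p" for p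
    using that mult[OF g(1)] by (metis dvdE mult.commute)
  ultimately have "L = {p. g dvd p}" by blast
  then show thesis by (rule that)
qed

text \<open>
  A commutative algebra over \<open>K[x]\<close>, given by its structure map \<open>\<theta>\<close>. The map is a plain function on the
  type of polynomials, so that \<open>K[x]\<close> keeps its type class arithmetic.
\<close>

locale line_algebra = cring A for A :: "('a, 'b) ring_scheme" (structure) +
  fixes \<theta> :: "'k::field poly \<Rightarrow> 'a"
  assumes closed [simp, intro]: "\<theta> p \<in> carrier A"
    and hom_add: "\<theta> (p + q) = \<theta> p \<oplus> \<theta> q"
    and hom_mult: "\<theta> (p * q) = \<theta> p \<otimes> \<theta> q"
    and hom_one [simp]: "\<theta> 1 = \<one>"
begin

lemma hom_zero [simp]: "\<theta> 0 = \<zero>"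
proof -
  have "\<theta> 0 \<oplus> \<theta> 0 = \<theta> 0" using hom_add[of 0 0] by simp
  then show ?thesis using add.l_cancel_one[of "\<theta> 0" "\<theta> 0"] by simp
qed

lemma hom_uminus: "\<theta> (- p) = \<ominus> \<theta> p"
  using hom_add[of "- p" p] minus_equality[of "\<theta> (- p)" "\<theta> p"] by simp

text \<open>
  An ideal has a generator of its contraction to the principal ideal domain \<open>K[x]\<close>.
\<close>

lemma trace_principal:
  assumes "ideal Q A"
  shows "\<exists>g. \<forall>p. \<theta> p \<in> Q \<longleftrightarrow> g dvd p"
proof -
  interpret Q: ideal Q A by fact
  obtain g where "{p. \<theta> p \<in> Q} = {p. g dvd p}"
  proof (rule poly_ideal_principal)
    show "0 \<in> {p. \<theta> p \<in> Q}" by (simp add: Q.zero_closed)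
    show "p + q \<in> {p. \<theta> p \<in> Q}" if "p \<in> {p. \<theta> p \<in> Q}" "q \<in> {p. \<theta> p \<in> Q}" for p q
      using that by (simp add: hom_add Q.a_closed)
    show "q * p \<in> {p. \<theta> p \<in> Q}" if "p \<in> {p. \<theta> p \<in> Q}" for p q
      using that by (simp add: hom_mult Q.I_l_closed)
  qed
  then show ?thesis by blast
qed

primrec span :: "'a list \<Rightarrow> 'a set" where
  "span [] = {\<zero>}"
| "span (e # es) = {\<theta> c \<otimes> e \<oplus> s | c s. s \<in> span es}"

lemma span_closed: "set es \<subseteq> carrier A \<Longrightarrow> span es \<subseteq> carrier A"
  by (induction es) auto

lemma zero_in_span: "set es \<subseteq> carrier A \<Longrightarrow> \<zero> \<in> span es"
proof (induction es)
  case (Cons e es)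
  then have "\<zero> = \<theta> 0 \<otimes> e \<oplus> \<zero>" by simp
  then show ?case using Cons unfolding span.simps by (intro CollectI exI[of _ 0] exI[of _ \<zero>]) auto
qed simp

lemma span_add:
  "set es \<subseteq> carrier A \<Longrightarrow> s \<in> span es \<Longrightarrow> t \<in> span es \<Longrightarrow> s \<oplus> t \<in> span es"
proof (induction es arbitrary: s t)
  case (Cons e es)
  from Cons.prems obtain c s' d t' where st: "s = \<theta> c \<otimes> e \<oplus> s'" "s' \<in> span es"
    "t = \<theta> d \<otimes> e \<oplus> t'" "t' \<in> span es" by auto
  have carr: "s' \<in> carrier A" "t' \<in> carrier A" "e \<in> carrier A"
    using st(2,4) Cons.prems(1) span_closed[of es] by auto
  have "s \<oplus> t = \<theta> (c + d) \<otimes> e \<oplus> (s' \<oplus> t')"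
    unfolding st(1,3) hom_add using carr closed[of c] closed[of d] by algebra
  moreover have "s' \<oplus> t' \<in> span es" using Cons.IH[OF _ st(2,4)] Cons.prems(1) by simp
  ultimately show ?case by auto
qed simp

lemma span_smult:
  "set es \<subseteq> carrier A \<Longrightarrow> s \<in> span es \<Longrightarrow> \<theta> c \<otimes> s \<in> span es"
proof (induction es arbitrary: s)
  case (Cons e es)
  from Cons.prems obtain d s' where st: "s = \<theta> d \<otimes> e \<oplus> s'" "s' \<in> span es" by auto
  have carr: "s' \<in> carrier A" "e \<in> carrier A"
    using st(2) Cons.prems(1) span_closed[of es] by auto
  have "\<theta> c \<otimes> s = \<theta> (c * d) \<otimes> e \<oplus> \<theta> c \<otimes> s'"
    unfolding st(1) hom_mult using carr closed[of c] closed[of d] by algebra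
  moreover have "\<theta> c \<otimes> s' \<in> span es" using Cons.IH[OF _ st(2)] Cons.prems(1) by simp
  ultimately show ?case by auto
qed simp

lemma smult_generator_in_span:
  "set es \<subseteq> carrier A \<Longrightarrow> e \<in> set es \<Longrightarrow> \<theta> c \<otimes> e \<in> span es"
proof (induction es)
  case (Cons f es)
  have f: "f \<in> carrier A" "set es \<subseteq> carrier A" using Cons.prems(1) by auto
  show ?case
  proof (cases "e = f")
    case True
    have "\<theta> c \<otimes> e = \<theta> c \<otimes> f \<oplus> \<zero>" using f True by simp
    then show ?thesis using zero_in_span[OF f(2)] by auto
  next
    case False
    then have e: "\<theta> c \<otimes> e \<in> span es" using Cons f by simp
    then have "\<theta> c \<otimes> e = \<theta> 0 \<otimes> f \<oplus> \<theta> c \<otimes> e"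
      using f span_closed[OF f(2)] by (simp add: subsetD)
    then show ?thesis using e unfolding span.simps by blast
  qed
qed simp

text \<open>
  Induction on the generators of the module: the coefficients of \<open>e\<close> in elements of \<open>Q\<close> form an ideal of
  \<open>K[x]\<close>. Once its generator \<open>g\<close> is realised by some \<open>q0 \<in> Q\<close>, a multiple of \<open>q0\<close> removes the
  coefficient of \<open>e\<close> from any given element of \<open>Q\<close>.
\<close>

lemma ideal_inter_span_finitely_generated:
  assumes Q: "ideal Q A" and "set es \<subseteq> carrier A"
  shows "\<exists>F\<subseteq>Q. finite F \<and> Q \<inter> span es \<subseteq> Idl F"
  using assms(2)
proof (induction es)
  case Nil
  have "\<zero> \<in> Idl {}"
    using additive_subgroup.zero_closed[OF ideal.axioms(1)[OF genideal_ideal[of "{}"]]] by simp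
  then show ?case by (intro exI[of _ "{}"]) auto
next
  case (Cons e es)
  interpret Q: ideal Q A by fact
  have es: "e \<in> carrier A" "set es \<subseteq> carrier A" using Cons.prems by auto
  obtain F where F: "F \<subseteq> Q" "finite F" "Q \<inter> span es \<subseteq> Idl F" using Cons.IH[OF es(2)] by blast
  have sc: "s \<in> carrier A" if "s \<in> span es" for s using that span_closed[OF es(2)] by blast
  define L where "L = {c. \<exists>s\<in>span es. \<theta> c \<otimes> e \<oplus> s \<in> Q}"
  obtain g where g: "L = {p. g dvd p}"
  proof (rule poly_ideal_principal)
    show "0 \<in> L" using zero_in_span[OF es(2)] es(1) Q.zero_closed
      by (auto simp: L_def intro!: bexI[of _ \<zero>])
  next
    fix p q assume "p \<in> L" "q \<in> L"
    then obtain s t where st: "s \<in> span es" "\<theta> p \<otimes> e \<oplus> s \<in> Q" "t \<in> span es" "\<theta> q \<otimes> e \<oplus> t \<in> Q"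
      by (auto simp: L_def)
    have "\<theta> (p + q) \<otimes> e \<oplus> (s \<oplus> t) = (\<theta> p \<otimes> e \<oplus> s) \<oplus> (\<theta> q \<otimes> e \<oplus> t)"
      unfolding hom_add using sc[OF st(1)] sc[OF st(3)] es(1) closed[of p] closed[of q] by algebra
    then have "\<theta> (p + q) \<otimes> e \<oplus> (s \<oplus> t) \<in> Q" using st by (simp add: Q.a_closed)
    then show "p + q \<in> L" using span_add[OF es(2) st(1,3)] by (auto simp: L_def)
  next
    fix p q assume "p \<in> L"
    then obtain s where st: "s \<in> span es" "\<theta> p \<otimes> e \<oplus> s \<in> Q" by (auto simp: L_def)
    have "\<theta> (q * p) \<otimes> e \<oplus> (\<theta> q \<otimes> s) = \<theta> q \<otimes> (\<theta> p \<otimes> e \<oplus> s)"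
      unfolding hom_mult using sc[OF st(1)] es(1) closed[of p] closed[of q] by algebra
    then have "\<theta> (q * p) \<otimes> e \<oplus> (\<theta> q \<otimes> s) \<in> Q" using st by (simp add: Q.I_l_closed)
    then show "q * p \<in> L" using span_smult[OF es(2) st(1)] by (auto simp: L_def)
  qed
  have "g \<in> L" using g by simp
  then obtain s0 where s0: "s0 \<in> span es" "\<theta> g \<otimes> e \<oplus> s0 \<in> Q" by (auto simp: L_def)
  define q0 where "q0 = \<theta> g \<otimes> e \<oplus> s0"
  have q0: "q0 \<in> carrier A" using s0 sc[OF s0(1)] es(1) by (simp add: q0_def)
  have Fc: "insert q0 F \<subseteq> carrier A" using F(1) Q.a_subset q0 by blast
  interpret G: ideal "Idl (insert q0 F)" A using Fc by (rule genideal_ideal)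
  have FG: "insert q0 F \<subseteq> Idl (insert q0 F)" using Fc by (rule genideal_self)
  then have sub: "Idl F \<subseteq> Idl (insert q0 F)" by (intro genideal_minimal G.is_ideal) simp
  have "a \<in> Idl (insert q0 F)" if a: "a \<in> Q" "a \<in> span (e # es)" for a
  proof -
    obtain c s where cs: "s \<in> span es" "a = \<theta> c \<otimes> e \<oplus> s" using a(2) by auto
    then have "c \<in> L" using a(1) by (auto simp: L_def)
    then obtain d where d: "c = d * g" using g by (auto simp: dvd_def mult.commute)
    define b where "b = s \<oplus> \<theta> (- d) \<otimes> s0"
    have bs: "b \<in> span es" unfolding b_def
      using span_add[OF es(2) cs(1) span_smult[OF es(2) s0(1)]] .
    have b: "b = a \<oplus> \<ominus> (\<theta> d \<otimes> q0)"
      unfolding b_def cs(2) q0_def d hom_mult hom_uminus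
      using sc[OF cs(1)] sc[OF s0(1)] es(1) closed[of d] closed[of g] by algebra
    have "b \<in> Q" unfolding b using a(1) s0(2)
      by (intro Q.a_closed Q.a_inv_closed Q.I_l_closed) (auto simp: q0_def)
    then have "b \<in> Idl (insert q0 F)" using bs F(3) sub by blast
    moreover have "a = b \<oplus> \<theta> d \<otimes> q0"
      unfolding b using q0 closed[of d] a(1) Q.Icarr[of a] by algebra
    ultimately show ?thesis using FG by (auto intro!: G.a_closed G.I_l_closed)
  qed
  then have "Q \<inter> span (e # es) \<subseteq> Idl (insert q0 F)" by blast
  moreover have "insert q0 F \<subseteq> Q" using F(1) s0(2) by (simp add: q0_def)
  ultimately show ?case using F(2) by (intro exI[of _ "insert q0 F"]) simp
qed

lemma noetherian_if_finite_module:
  assumes "set es \<subseteq> carrier A" "carrier A \<subseteq> span es"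
  shows "noetherian_ring A"
proof (rule noetherian_ringI)
  fix Q assume Q: "ideal Q A"
  interpret Q: ideal Q A by fact
  obtain F where F: "F \<subseteq> Q" "finite F" "Q \<inter> span es \<subseteq> Idl F"
    using ideal_inter_span_finitely_generated[OF Q assms(1)] by blast
  have "Q \<inter> span es = Q" using assms(2) Q.a_subset by blast
  then have "Q = Idl F" using F genideal_minimal[OF Q F(1)] by simp
  then show "\<exists>F\<subseteq>carrier A. finite F \<and> Q = Idl F" using F(1,2) Q.a_subset by blast
qed

end

section \<open>Rings that are a polynomial ring in one variable up to nilpotents\<close>

text \<open>
  The two assumptions say that \<open>K[x]\<close> maps isomorphically onto the quotient of \<open>A\<close> by its nilradical:
  geometrically, \<open>A\<close> is the coordinate ring of a line with nilpotent structure.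
\<close>

locale thickened_line = line_algebra +
  assumes nilpotent_part: "a \<in> carrier A \<Longrightarrow> \<exists>p. \<exists>k::nat. (a \<ominus> \<theta> p) [^] k = \<zero>"
    and reduced: "\<theta> p [^] (k::nat) = \<zero> \<Longrightarrow> p = 0"
begin

lemma nilpotent_mem_prime:
  assumes "primeideal Q A" "a \<in> carrier A" "a [^] (k::nat) = \<zero>"
  shows "a \<in> Q"
proof -
  interpret Q: primeideal Q A by fact
  have "a [^] (k::nat) \<in> Q \<Longrightarrow> a \<in> Q"
  proof (induction k)
    case 0
    then show ?case using Q.one_imp_carrier Q.I_notcarr by simp
  next
    case (Suc k)
    then show ?case using Q.I_prime[of "a [^] k" a] assms(2) by auto
  qed
  then show ?thesis using assms(3) by simp
qed

lemma theta_plus_nilpotent: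
  assumes "a \<in> carrier A"
  obtains p d k where "d \<in> carrier A" "d [^] (k::nat) = \<zero>" "a = \<theta> p \<oplus> d"
proof -
  obtain p k where pk: "(a \<ominus> \<theta> p) [^] (k::nat) = \<zero>" using nilpotent_part[OF assms] by blast
  have "a = \<theta> p \<oplus> (a \<ominus> \<theta> p)"
  proof -
    have "\<theta> p \<in> carrier A" by simp
    with assms show ?thesis by algebra
  qed
  moreover have "a \<ominus> \<theta> p \<in> carrier A" using assms by simp
  ultimately show thesis using pk by (rule that[rotated 2])
qed

text \<open>
  Prime ideals contain all nilpotent elements, so they are determined by their contractions to \<open>K[x]\<close>.
\<close>

lemma prime_subset_iff_trace:
  assumes "primeideal Q A" "primeideal Q' A"
  shows "Q \<subseteq> Q' \<longleftrightarrow> (\<forall>p. \<theta> p \<in> Q \<longrightarrow> \<theta> p \<in> Q')"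
proof (intro iffI subsetI)
  fix a assume *: "\<forall>p. \<theta> p \<in> Q \<longrightarrow> \<theta> p \<in> Q'" and a: "a \<in> Q"
  interpret Q: primeideal Q A by fact
  interpret Q': primeideal Q' A by fact
  have ac: "a \<in> carrier A" using a Q.Icarr by simp
  obtain p d k where d: "d \<in> carrier A" "d [^] (k::nat) = \<zero>" "a = \<theta> p \<oplus> d"
    by (rule theta_plus_nilpotent[OF ac])
  have dQ: "d \<in> Q" "d \<in> Q'" using nilpotent_mem_prime d(1,2) assms by blast+
  have "\<theta> p = a \<oplus> \<ominus> d"
  proof -
    have "\<theta> p \<in> carrier A" by simp
    with d(1,3) show ?thesis by algebra
  qed
  then have "\<theta> p \<in> Q" using a dQ Q.a_closed Q.a_inv_closed by simp
  then show "a \<in> Q'" using * d(3) dQ Q'.a_closed by auto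
qed auto

text \<open>
  The contractions to \<open>K[x]\<close> of a chain of three primes are strictly increasing. The generator \<open>g1\<close> of
  the middle one is nonzero and a multiple of the generator \<open>g2\<close> of the largest one. As \<open>g1\<close> is prime,
  \<open>g2\<close> is a unit or associated to \<open>g1\<close>.
\<close>

lemma height_le_one:
  shows "height A P \<le> 1"
  unfolding height_def
proof (rule Sup_least, clarify)
  fix k and C :: "nat \<Rightarrow> 'a set"
  assume pr: "\<forall>i\<le>k. primeideal (C i) A" and ch: "\<forall>i<k. C i \<subset> C (Suc i)"
  show "enat k \<le> 1"
  proof (rule ccontr)
    assume "\<not> enat k \<le> 1"
    then have k: "2 \<le> k" by (simp add: one_enat_def)
    have pr': "primeideal (C 0) A" "primeideal (C 1) A" "primeideal (C 2) A" using pr k by auto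
    interpret Q0: primeideal "C 0" A by fact
    interpret Q1: primeideal "C 1" A by fact
    interpret Q2: primeideal "C 2" A by fact
    have sub: "C 0 \<subset> C 1" "C 1 \<subset> C 2" using ch k by (auto simp: numeral_2_eq_2)
    obtain g1 where g1: "\<And>p. \<theta> p \<in> C 1 \<longleftrightarrow> g1 dvd p" using trace_principal[OF Q1.is_ideal] by blast
    obtain g2 where g2: "\<And>p. \<theta> p \<in> C 2 \<longleftrightarrow> g2 dvd p" using trace_principal[OF Q2.is_ideal] by blast
    obtain p where p: "\<theta> p \<in> C 1" "\<theta> p \<notin> C 0"
      using sub(1) prime_subset_iff_trace[OF pr'(2,1)] by auto
    have "p \<noteq> 0" using p(2) Q0.zero_closed by auto
    then have "g1 \<noteq> 0" using p(1) g1[of p] by auto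
    have "\<theta> g1 \<in> C 2" using g1[of g1] sub(2) by auto
    then obtain h where h: "g1 = g2 * h" using g2[of g1] unfolding dvd_def by blast
    have "\<theta> g2 \<otimes> \<theta> h \<in> C 1" using g1[of g1] h by (simp add: hom_mult)
    then consider "\<theta> g2 \<in> C 1" | "\<theta> h \<in> C 1" using Q1.I_prime by blast
    then show False
    proof cases
      case 1
      then have "g1 dvd g2" using g1[of g2] by simp
      then have "C 2 \<subseteq> C 1" unfolding prime_subset_iff_trace[OF pr'(3,2)] g1 g2
        using dvd_trans by blast
      then show False using sub(2) by blast
    next
      case 2
      then obtain u where "h = g1 * u" using g1[of h] unfolding dvd_def by blast
      with h \<open>g1 \<noteq> 0\<close> have "g2 * u = 1" by (simp add: algebra_simps)
      then have "\<theta> 1 \<in> C 2" using g2[of 1] by (metis dvd_triv_left)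
      then show False using Q2.one_imp_carrier Q2.I_notcarr by simp
    qed
  qed
qed

text \<open>
  If \<open>x \<notin> P\<close>, then \<open>x\<close> is invertible modulo \<open>P\<close>; replacing its inverse by a congruent polynomial \<open>q\<close> puts
  \<open>1 - q * x\<close> into \<open>P\<close>.
\<close>

lemma maximal_contains_theta:
  assumes "maximalideal P A"
  obtains p where "p \<noteq> 0" "\<theta> p \<in> P"
proof -
  have pr: "primeideal P A" using maximalideal_prime[OF assms] .
  interpret P: maximalideal P A by fact
  show thesis
  proof (cases "\<theta> [:0, 1:] \<in> P")
    case True
    then show ?thesis using that[of "[:0, 1:]"] by simp
  next
    case False
    define x where "x = \<theta> [:0, 1:]"
    have x: "x \<in> carrier A" by (simp add: x_def)
    have id: "ideal (P <+> PIdl x) A" using add_ideals[OF P.is_ideal cgenideal_ideal[OF x]] .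
    have "P \<subseteq> P <+> PIdl x"
    proof
      fix q assume q: "q \<in> P"
      have "q = q \<oplus> \<zero> \<otimes> x" using q x P.Icarr by simp
      then show "q \<in> P <+> PIdl x" unfolding set_add_def' cgenideal_def using q by blast
    qed
    moreover have "x = \<zero> \<oplus> \<one> \<otimes> x" using x by simp
    then have "x \<in> P <+> PIdl x" unfolding set_add_def' cgenideal_def
      using P.zero_closed by blast
    ultimately have "P <+> PIdl x = carrier A"
      using P.I_maximal[OF id] False x_def ideal.Icarr[OF id] by blast
    then have "\<one> \<in> P <+> PIdl x" by simp
    then obtain u a where u: "u \<in> P" and a: "a \<in> carrier A" and one: "\<one> = u \<oplus> a \<otimes> x"
      unfolding set_add_def' cgenideal_def by blast
    obtain q d k where d: "d \<in> carrier A" "d [^] (k::nat) = \<zero>" "a = \<theta> q \<oplus> d"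
      by (rule theta_plus_nilpotent[OF a])
    have dP: "d \<in> P" using nilpotent_mem_prime[OF pr d(1,2)] .
    have uc: "u \<in> carrier A" using u P.Icarr by simp
    have "\<theta> (1 - q * [:0, 1:]) = \<one> \<oplus> \<ominus> (\<theta> q \<otimes> x)"
      by (simp only: diff_conv_add_uminus hom_add hom_uminus hom_mult hom_one x_def)
    also have "\<dots> = u \<oplus> x \<otimes> d"
      unfolding one d(3) using uc d(1) x closed[of q] by algebra
    also have "\<dots> \<in> P" using u dP x by (intro P.a_closed P.I_l_closed)
    finally have "\<theta> (1 - q * [:0, 1:]) \<in> P" .
    moreover have "1 - q * [:0, 1:] \<noteq> 0"
    proof
      assume "1 - q * [:0, 1:] = 0"
      then have "poly (1 - q * [:0, 1:]) 0 = 0" by simp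
      then show False by simp
    qed
    ultimately show ?thesis by (rule that[rotated])
  qed
qed

text \<open>
  The nonzero polynomials form a multiplicative set that does not meet \<open>0\<close>; a prime avoiding it
  lies strictly below every prime that contains one of them.
\<close>

lemma height_pos:
  assumes "primeideal P A" "\<theta> p \<in> P" "p \<noteq> 0"
  shows "1 \<le> height A P"
proof -
  define S where "S = \<theta> ` (- {0})"
  have "{\<zero>} \<inter> S = {}" using reduced[of _ 1] by (auto simp: S_def nat_pow_eone)
  moreover have "S \<subseteq> carrier A" by (auto simp: S_def)
  moreover have "\<one> \<in> S" unfolding S_def by (rule image_eqI[of _ _ 1]) simp_all
  moreover have "s \<otimes> t \<in> S" if "s \<in> S" "t \<in> S" for s t
    using that unfolding S_def by (auto simp: hom_mult[symmetric])
  ultimately obtain Q where Q: "primeideal Q A" "Q \<inter> S = {}"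
    using exists_prime_avoiding[OF zeroideal] by metis
  interpret Q: primeideal Q A by fact
  interpret P: primeideal P A by fact
  have "Q \<subseteq> P" unfolding prime_subset_iff_trace[OF Q(1) assms(1)]
    using Q(2) P.zero_closed by (force simp: S_def)
  moreover have "\<theta> p \<notin> Q" using Q(2) assms(3) by (auto simp: S_def)
  ultimately have "Q \<subset> P" using assms(2) by blast
  then show ?thesis unfolding one_enat_def
    using Q(1) assms(1) by (intro le_heightI[of "\<lambda>i. if i = 0 then Q else P"]) auto
qed

lemma cohen_macaulayI:
  assumes noeth: "noetherian_ring A"
    and nzd: "\<And>p a. p \<noteq> 0 \<Longrightarrow> a \<in> carrier A \<Longrightarrow> \<theta> p \<otimes> a = \<zero> \<Longrightarrow> a = \<zero>"
  shows "cohen_macaulay A"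
  unfolding cohen_macaulay_def
proof (intro conjI allI impI noeth is_cring)
  fix P assume P: "maximalideal P A"
  have pr: "primeideal P A" using maximalideal_prime[OF P] .
  interpret P: primeideal P A by fact
  obtain p where p: "p \<noteq> 0" "\<theta> p \<in> P" using maximal_contains_theta[OF P] .
  have "regular_sequence A [\<theta> p]"
    unfolding regular_sequence_def
  proof (intro conjI allI ballI impI)
    have "Idl (set [\<theta> p]) \<subseteq> P" using p by (intro genideal_minimal P.is_ideal) auto
    then show "Idl (set [\<theta> p]) \<noteq> carrier A" using P.I_notcarr P.a_subset by blast
  next
    fix i r assume "i < length [\<theta> p]" and r: "r \<in> carrier A"
      and *: "[\<theta> p] ! i \<otimes> r \<in> Idl (set (take i [\<theta> p]))"
    then have i: "i = 0" by simp
    have "Idl {} = {\<zero>}" using genideal_minimal[OF zeroideal, of "{}"]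
        additive_subgroup.zero_closed[OF ideal.axioms(1)[OF genideal_ideal[of "{}"]]] by auto
    then show "r \<in> Idl (set (take i [\<theta> p]))" using * i r p nzd[of p r] by auto
  qed simp
  then have "enat (length [\<theta> p]) \<le> depth A P" unfolding depth_def using p(2)
    by (intro Sup_upper CollectI exI[of _ "[\<theta> p]"] conjI) simp_all
  then have "1 \<le> depth A P" by (simp add: one_enat_def)
  then show "depth A P = height A P" using depth_le_height[OF pr] height_le_one[of P]
    by (meson order.antisym order.trans)
qed

text \<open>
  A maximal ideal \<open>P\<close> over \<open>x\<close> has positive height, so it contains a nonzerodivisor
  \<open>y = \<theta> p + d\<close> with \<open>d\<close> nilpotent, and \<open>x\<close> divides \<open>p\<close>. If \<open>x\<close> annihilates \<open>a\<close>, then so does \<open>\<theta> p\<close>,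
  whence \<open>y\<close> acts on \<open>a\<close> as the nilpotent \<open>d\<close>, and some power of \<open>y\<close> annihilates \<open>a\<close>.
\<close>

lemma cohen_macaulayD:
  assumes cm: "cohen_macaulay A" and a: "a \<in> carrier A" "\<theta> [:0, 1:] \<otimes> a = \<zero>"
  shows "a = \<zero>"
proof -
  define x where "x = \<theta> [:0, 1:]"
  have x: "x \<in> carrier A" by (simp add: x_def)
  \<comment> \<open>\<open>x\<close> is not a unit: if \<open>q\<close> were its inverse up to nilpotents, then \<open>1 - q * x\<close> would be nilpotent.\<close>
  have "PIdl x \<inter> {\<one>} = {}"
  proof (rule ccontr)
    assume "PIdl x \<inter> {\<one>} \<noteq> {}"
    then obtain b where b: "b \<in> carrier A" "\<one> = b \<otimes> x" by (auto simp: cgenideal_def)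
    obtain q d k where d: "d \<in> carrier A" "d [^] (k::nat) = \<zero>" "b = \<theta> q \<oplus> d"
      by (rule theta_plus_nilpotent[OF b(1)])
    have "\<theta> (1 - q * [:0, 1:]) = \<one> \<oplus> \<ominus> (\<theta> q \<otimes> x)"
      by (simp only: diff_conv_add_uminus hom_add hom_uminus hom_mult hom_one x_def)
    also have "\<dots> = d \<otimes> x"
      unfolding b(2) d(3) using d(1) x closed[of q] by algebra
    finally have "\<theta> (1 - q * [:0, 1:]) [^] k = \<zero>" using d(1,2) x by (simp add: nat_pow_distrib)
    then have "1 - q * [:0, 1:] = 0" by (rule reduced)
    then have "poly (1 - q * [:0, 1:]) 0 = 0" by simp
    then show False by simp
  qed
  then obtain P where pr: "primeideal P A" and XP: "PIdl x \<subseteq> P" and dj: "P \<inter> {\<one>} = {}"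
    and mx: "\<And>J. ideal J A \<Longrightarrow> P \<subseteq> J \<Longrightarrow> J \<inter> {\<one>} = {} \<Longrightarrow> J = P"
    using exists_prime_avoiding[OF cgenideal_ideal[OF x], of "{\<one>}"] by (auto simp: l_one)
  interpret P: primeideal P A by fact
  have "maximalideal P A"
  proof (rule maximalidealI[OF P.is_ideal P.I_notcarr])
    fix J assume "ideal J A" "P \<subseteq> J" "J \<subseteq> carrier A"
    then show "J = P \<or> J = carrier A" using mx[of J] ideal.one_imp_carrier[of J A] by blast
  qed
  then have "depth A P = height A P" using cm by (auto simp: cohen_macaulay_def)
  moreover have "x \<in> P" using XP cgenideal_self[OF x] by blast
  then have "1 \<le> height A P" using height_pos[OF pr, of "[:0, 1:]"] by (simp add: x_def)
  ultimately have "1 \<le> depth A P" by simp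
  then obtain xs where xs: "regular_sequence A xs" "set xs \<subseteq> P" "xs \<noteq> []"
  proof -
    have "\<exists>xs. regular_sequence A xs \<and> set xs \<subseteq> P \<and> xs \<noteq> []"
    proof (rule ccontr)
      assume "\<not> ?thesis"
      then have "depth A P \<le> 0" unfolding depth_def
        by (intro Sup_least) (auto simp: zero_enat_def)
      with \<open>1 \<le> depth A P\<close> have "(1::enat) \<le> 0" by (rule order_trans)
      then show False by simp
    qed
    then show thesis by (elim exE conjE) (rule that)
  qed
  define y where "y = xs ! 0"
  have y: "y \<in> P" using xs by (auto simp: y_def)
  have yc: "y \<in> carrier A" using y P.Icarr by simp
  have "Idl {} = {\<zero>}" using genideal_minimal[OF zeroideal, of "{}"]
      additive_subgroup.zero_closed[OF ideal.axioms(1)[OF genideal_ideal[of "{}"]]] by auto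
  then have nzd: "r = \<zero>" if "r \<in> carrier A" "y \<otimes> r = \<zero>" for r
    using xs(1,3) that unfolding regular_sequence_def y_def by (auto dest!: spec[of _ 0])
  obtain p d k where d: "d \<in> carrier A" "d [^] (k::nat) = \<zero>" "y = \<theta> p \<oplus> d"
    by (rule theta_plus_nilpotent[OF yc])
  have dP: "d \<in> P" using nilpotent_mem_prime[OF pr d(1,2)] .
  have "\<theta> p = y \<oplus> \<ominus> d" unfolding d(3) using closed[of p] d(1) by algebra
  then have pP: "\<theta> p \<in> P" using y dP P.a_closed P.a_inv_closed by simp
  obtain g where g: "\<And>p. \<theta> p \<in> P \<longleftrightarrow> g dvd p" using trace_principal[OF P.is_ideal] by blast
  obtain c q where pq: "p = pCons c q" by (cases p)
  have "c = 0"
  proof (rule ccontr)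
    assume c: "c \<noteq> 0"
    have gX: "g dvd [:0, 1:]" using \<open>x \<in> P\<close> g x_def by blast
    have "p = [:c:] + [:0, 1:] * q" by (simp add: pq)
    then have "g dvd [:c:]" using pP g[of p] gX by (metis dvd_add_left_iff dvd_mult2)
    then have "g dvd [:c:] * [:inverse c:]" by (rule dvd_mult2)
    then have "\<theta> 1 \<in> P" using g[of 1] c by (simp add: one_pCons)
    then show False using dj by simp
  qed
  then have "p = q * [:0, 1:]" by (simp add: pq)
  then have "\<theta> p \<otimes> a = \<theta> q \<otimes> (x \<otimes> a)" using a(1) x by (simp only: hom_mult x_def m_assoc closed)
  then have pa: "\<theta> p \<otimes> a = \<zero>" using a by (simp add: x_def)
  have "y [^] j \<otimes> a = d [^] j \<otimes> a" for j :: nat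
  proof (induction j)
    case (Suc j)
    have "y [^] Suc j \<otimes> a = (\<theta> p \<oplus> d) \<otimes> (y [^] j \<otimes> a)"
      using yc a(1) d(1) closed[of p] by (simp add: d(3) m_ac)
    also have "\<dots> = (\<theta> p \<oplus> d) \<otimes> (d [^] j \<otimes> a)" unfolding Suc.IH ..
    also have "\<dots> = d [^] j \<otimes> (\<theta> p \<otimes> a) \<oplus> d [^] Suc j \<otimes> a"
      using a(1) d(1) closed[of p] by (simp add: l_distr r_distr m_ac)
    finally show ?case using pa a(1) d(1) by simp
  qed (use a in simp)
  then have yk: "y [^] k \<otimes> a = \<zero>" using d a by simp
  have "y [^] j \<otimes> a = \<zero> \<Longrightarrow> a = \<zero>" for j :: nat
  proof (induction j)
    case (Suc j)
    have "y [^] Suc j \<otimes> a = y \<otimes> (y [^] j \<otimes> a)" using yc a(1) by (simp add: m_assoc m_comm[of "y [^] j" y])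
    then have "y \<otimes> (y [^] j \<otimes> a) = \<zero>" using Suc.prems by metis
    then have "y [^] j \<otimes> a = \<zero>" using yc a(1) nzd[of "y [^] j \<otimes> a"] by simp
    then show ?case by (rule Suc.IH)
  qed (use a in simp)
  then show ?thesis using yk .
qed

end

section \<open>The initial ideal of a monomial curve\<close>

lemma type_ring_simps [simp]:
  "carrier ring_of_type_algebra = UNIV" "x \<otimes>\<^bsub>ring_of_type_algebra\<^esub> y = x * y"
  "x \<oplus>\<^bsub>ring_of_type_algebra\<^esub> y = x + y" "\<one>\<^bsub>ring_of_type_algebra\<^esub> = 1" "\<zero>\<^bsub>ring_of_type_algebra\<^esub> = 0"
  by (simp_all add: ring_of_type_algebra_def)

lemma ideal_type_ring_iff:
  fixes L :: "'r::comm_ring_1 set"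
  shows "ideal L ring_of_type_algebra \<longleftrightarrow>
    0 \<in> L \<and> (\<forall>x\<in>L. \<forall>y\<in>L. x + y \<in> L) \<and> (\<forall>x\<in>L. \<forall>r. r * x \<in> L)"
proof
  assume "ideal L (ring_of_type_algebra :: 'r ring)"
  then interpret I: ideal L "ring_of_type_algebra :: 'r ring" .
  have "0 \<in> L" using additive_subgroup.zero_closed[OF I.additive_subgroup_axioms] unfolding type_ring_simps .
  moreover have "x + y \<in> L" if "x \<in> L" "y \<in> L" for x y
    using additive_subgroup.a_closed[OF I.additive_subgroup_axioms that] unfolding type_ring_simps .
  moreover have "r * x \<in> L" if "x \<in> L" for x r
    using I.I_l_closed[OF that, of r] unfolding type_ring_simps by simp
  ultimately show "0 \<in> L \<and> (\<forall>x\<in>L. \<forall>y\<in>L. x + y \<in> L) \<and> (\<forall>x\<in>L. \<forall>r. r * x \<in> L)"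
    by blast
next
  assume L: "0 \<in> L \<and> (\<forall>x\<in>L. \<forall>y\<in>L. x + y \<in> L) \<and> (\<forall>x\<in>L. \<forall>r. r * x \<in> L)"
  interpret cring "ring_of_type_algebra :: 'r ring" by (rule cring_from_type_algebra)
  have "(- 1) * x \<in> L" if "x \<in> L" for x using L that by blast
  moreover have "\<ominus>\<^bsub>ring_of_type_algebra\<^esub> x = (- 1) * x" for x :: 'r
    using minus_equality[of "- x" x] by simp
  ultimately have neg: "\<ominus>\<^bsub>ring_of_type_algebra\<^esub> x \<in> L" if "x \<in> L" for x
    using that by metis
  show "ideal L (ring_of_type_algebra :: 'r ring)"
  proof (intro idealI add.subgroupI ring_axioms)
    show "L \<noteq> {}" using L by blast
    show "\<ominus>\<^bsub>ring_of_type_algebra\<^esub> x \<in> L" if "x \<in> L" for x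
      using neg[OF that] .
  qed (use L in \<open>auto simp: mult.commute\<close>)
qed

lemma mpoly_induct [case_names single add]:
  fixes f :: "'m \<Rightarrow>\<^sub>0 'k::comm_monoid_add"
  assumes single: "\<And>m c. P (Poly_Mapping.single m c)" and add: "\<And>f g. P f \<Longrightarrow> P g \<Longrightarrow> P (f + g)"
  shows "P f"
proof -
  have "finite K \<Longrightarrow> Poly_Mapping.keys f = K \<Longrightarrow> P f" for K f
  proof (induction K arbitrary: f rule: finite_induct)
    case empty
    then have "f = Poly_Mapping.single undefined 0" by simp
    then show ?case using single by metis
  next
    case (insert m K)
    define g where "g = Poly_Mapping.update m 0 f"
    have "f = g + Poly_Mapping.single m (Poly_Mapping.lookup f m)"
      by (rule poly_mapping_eqI) (auto simp: g_def lookup_add lookup_update lookup_single when_def)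
    moreover have "Poly_Mapping.keys g = K" using insert by (auto simp: g_def keys_update)
    ultimately show ?case using add[OF insert.IH single] by metis
  qed
  then show ?thesis using finite_keys by blast
qed

text \<open>
  The values are polynomials in one variable because the parametrisation takes values there;
  scalar functionals are recovered as constant polynomials.
\<close>

definition lin_ext :: "('m \<Rightarrow> 'k::comm_ring_1 poly) \<Rightarrow> ('m \<Rightarrow>\<^sub>0 'k) \<Rightarrow> 'k poly" where
  "lin_ext \<phi> f = (\<Sum>m\<in>Poly_Mapping.keys f. Polynomial.smult (Poly_Mapping.lookup f m) (\<phi> m))"

lemma lin_ext_superset:
  assumes "finite M" "Poly_Mapping.keys f \<subseteq> M"
  shows "lin_ext \<phi> f = (\<Sum>m\<in>M. Polynomial.smult (Poly_Mapping.lookup f m) (\<phi> m))"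
  unfolding lin_ext_def using assms by (intro sum.mono_neutral_left) (auto simp: in_keys_iff)

lemma lin_ext_add: "lin_ext \<phi> (f + g) = lin_ext \<phi> f + lin_ext \<phi> g"
proof -
  have "Poly_Mapping.keys (f + g) \<subseteq> Poly_Mapping.keys f \<union> Poly_Mapping.keys g" by (rule keys_add)
  then show ?thesis
    by (simp add: lin_ext_superset[of "Poly_Mapping.keys f \<union> Poly_Mapping.keys g"] lookup_add smult_add_left sum.distrib)
qed

lemma lin_ext_single [simp]: "lin_ext \<phi> (Poly_Mapping.single m c) = Polynomial.smult c (\<phi> m)"
  by (simp add: lin_ext_superset[of "{m}"])

lemma lin_ext_zero [simp]: "lin_ext \<phi> 0 = 0"
  by (simp add: lin_ext_def)

lemma lin_ext_diff: "lin_ext \<phi> (f - g) = lin_ext \<phi> f - lin_ext \<phi> g"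
  using lin_ext_add[of \<phi> "f - g" g] by simp

lemma coeff_lin_ext:
  "Polynomial.coeff (lin_ext \<phi> f) w = (\<Sum>m\<in>Poly_Mapping.keys f. Poly_Mapping.lookup f m * Polynomial.coeff (\<phi> m) w)"
  by (simp add: lin_ext_def coeff_sum)

lemma lin_ext_single_mult:
  "lin_ext \<phi> (Poly_Mapping.single a c * f) = Polynomial.smult c (lin_ext (\<lambda>m. \<phi> (a + m)) f)"
  by (induction f rule: mpoly_induct)
     (simp_all add: mult_single distrib_left lin_ext_add smult_add_right)

definition weight :: "('v::finite \<Rightarrow> nat) \<Rightarrow> ('v \<Rightarrow>\<^sub>0 nat) \<Rightarrow> nat" where
  "weight n m = (\<Sum>i\<in>UNIV. Poly_Mapping.lookup m i * n i)"

lemma weight_add [simp]: "weight n (a + b) = weight n a + weight n b"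
  by (simp add: weight_def lookup_add distrib_right sum.distrib)

lemma weight_single [simp]: "weight n (Poly_Mapping.single v k) = k * n v"
  by (simp add: weight_def lookup_single when_def if_distrib[of "\<lambda>x. x * _"] cong: if_cong)

lemma mdegree_add [simp]: "mdegree (a + b) = mdegree a + mdegree b"
  by (simp add: mdegree_def lookup_add sum.distrib)

lemma mdegree_single [simp]: "mdegree (Poly_Mapping.single v k) = k"
  by (simp add: mdegree_def lookup_single when_def if_distrib[of "\<lambda>x. x * _"] cong: if_cong)

lemma curve_hom_eq_lin_ext:
  fixes f :: "('v::finite, 'k::comm_ring_1) mpoly"
  shows "curve_hom n f = lin_ext (\<lambda>m. Polynomial.monom 1 (weight n m)) f"
proof -
  have "(\<Prod>i\<in>I. Polynomial.monom (1::'k) (n i) ^ Poly_Mapping.lookup m i)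
      = Polynomial.monom 1 (\<Sum>i\<in>I. Poly_Mapping.lookup m i * n i)" if "finite I" for I and m :: "'v \<Rightarrow>\<^sub>0 nat"
    using that by (induction I rule: finite_induct)
      (simp_all add: monom_power mult_monom mult.commute)
  then show ?thesis by (simp add: curve_hom_def lin_ext_def weight_def)
qed

text \<open>
  For such \<open>m\<close>, the degree is the order of \<open>t ^ weight n m\<close> with respect to the filtration of the coordinate ring
  of the curve by the powers of the ideal of the origin.
\<close>

definition maximal_degree :: "('v::finite \<Rightarrow> nat) \<Rightarrow> ('v \<Rightarrow>\<^sub>0 nat) \<Rightarrow> bool" where
  "maximal_degree n m \<longleftrightarrow> (\<forall>m'. weight n m' = weight n m \<longrightarrow> mdegree m' \<le> mdegree m)"

text \<open>
  The map from the polynomial ring to the associated graded ring of the curve, which has the same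
  underlying vector space as the coordinate ring. As a map into \<open>K[t]\<close> it is linear but
  not multiplicative: in the graded ring, a product of powers of \<open>t\<close> is zero if their orders do not
  add up.
\<close>

definition tangent_hom :: "('v::finite \<Rightarrow> nat) \<Rightarrow> ('v, 'k::comm_ring_1) mpoly \<Rightarrow> 'k poly" where
  "tangent_hom n = lin_ext (\<lambda>m. if maximal_degree n m then Polynomial.monom 1 (weight n m) else 0)"

lemma maximal_degree_addD:
  assumes "maximal_degree n (a + m)"
  shows "maximal_degree n m"
  unfolding maximal_degree_def
proof (intro allI impI)
  fix m' assume "weight n m' = weight n m"
  then have "mdegree (a + m') \<le> mdegree (a + m)"
    by (intro assms[unfolded maximal_degree_def, rule_format]) simp
  then show "mdegree m' \<le> mdegree m" by simp
qed

lemma maximal_degree_cong: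
  "maximal_degree n m \<Longrightarrow> weight n m' = weight n m \<Longrightarrow> maximal_degree n m' \<longleftrightarrow> mdegree m' = mdegree m"
  unfolding maximal_degree_def by (metis order.antisym order_refl)

lemma mdegree_le_weight: "(\<forall>i. 0 < n i) \<Longrightarrow> mdegree m \<le> weight n m"
  unfolding mdegree_def weight_def by (intro sum_mono) (simp add: Suc_leI)

lemma exists_maximal_degree:
  assumes "\<forall>i. 0 < n i"
  shows "\<exists>m'. weight n m' = weight n m \<and> maximal_degree n m'"
proof -
  have "\<exists>m'. weight n m' = weight n m \<and> (\<forall>m''. weight n m'' = weight n m \<longrightarrow> mdegree m'' \<le> mdegree m')"
    by (rule ex_has_greatest_nat[of "\<lambda>m'. weight n m' = weight n m" m mdegree "Suc (weight n m)"])
       (simp, metis assms le_imp_less_Suc mdegree_le_weight)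
  then show ?thesis unfolding maximal_degree_def by metis
qed

lemma lookup_homogeneous_component:
  "Poly_Mapping.lookup (homogeneous_component d f) m = (if mdegree m = d then Poly_Mapping.lookup f m else 0)"
  unfolding homogeneous_component_def lookup_sum lookup_single
  by (auto simp: when_def in_keys_iff)

lemma lookup_initial_form:
  "Poly_Mapping.lookup (initial_form f) m =
    (if mdegree m = (LEAST d. \<exists>m\<in>Poly_Mapping.keys f. mdegree m = d) then Poly_Mapping.lookup f m else 0)"
  by (simp add: initial_form_def lookup_homogeneous_component)

lemma initial_form_homogeneous:
  assumes "\<And>m. m \<in> Poly_Mapping.keys f \<Longrightarrow> mdegree m = d"
  shows "initial_form f = f"
proof (cases "f = 0")
  case False
  then have "(\<exists>m\<in>Poly_Mapping.keys f. mdegree m = e) \<longleftrightarrow> e = d" for e using assms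
    by (metis all_not_in_conv keys_eq_empty)
  then have "(LEAST e. \<exists>m\<in>Poly_Mapping.keys f. mdegree m = e) = d" by (intro Least_equality) auto
  then show ?thesis using assms
    by (intro poly_mapping_eqI) (auto simp: lookup_initial_form in_keys_iff)
qed (simp add: poly_mapping_eq_iff lookup_initial_form fun_eq_iff)

lemma initial_form_binomial:
  assumes "mdegree m < mdegree m'" "c \<noteq> 0"
  shows "initial_form (Poly_Mapping.single m c - Poly_Mapping.single m' c) = Poly_Mapping.single m c"
proof -
  define f where "f = Poly_Mapping.single m c - Poly_Mapping.single m' c"
  have neq: "m \<noteq> m'" using assms by auto
  have lk: "Poly_Mapping.lookup f u = (if u = m then c else if u = m' then - c else 0)" for u
    using neq by (auto simp: f_def lookup_minus lookup_single when_def)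
  have "Poly_Mapping.keys f = {m, m'}" using assms neq by (auto simp: in_keys_iff lk split: if_splits)
  then have "(LEAST d. \<exists>m\<in>Poly_Mapping.keys f. mdegree m = d) = mdegree m"
    using assms by (intro Least_equality) auto
  then show ?thesis unfolding f_def[symmetric] using assms
    by (intro poly_mapping_eqI) (auto simp: lookup_initial_form lk lookup_single when_def)
qed

lemma coeff_tangent_hom:
  assumes "finite M" "Poly_Mapping.keys f \<subseteq> M"
  shows "Polynomial.coeff (tangent_hom n f) w =
    (\<Sum>m\<in>M. if maximal_degree n m \<and> weight n m = w then Poly_Mapping.lookup f m else 0)"
  unfolding tangent_hom_def lin_ext_superset[OF assms]
  by (auto simp: coeff_sum intro!: sum.cong)

lemma coeff_curve_hom:
  "Polynomial.coeff (curve_hom n f) w = (\<Sum>m\<in>Poly_Mapping.keys f. if weight n m = w then Poly_Mapping.lookup f m else 0)"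
  by (auto simp: curve_hom_eq_lin_ext coeff_lin_ext intro!: sum.cong)

text \<open>
  Suppose a monomial of maximal degree and weight \<open>w\<close> occurs in the initial form. Then all
  monomials of \<open>f\<close> with weight \<open>w\<close> have the same degree, so they all occur in the initial
  form, and their coefficients add up to zero because \<open>f\<close> vanishes on the curve.
\<close>

lemma tangent_hom_initial_form:
  assumes "curve_hom n f = 0"
  shows "tangent_hom n (initial_form f) = 0"
proof (rule poly_eqI)
  fix w
  define D where "D = (LEAST d. \<exists>m\<in>Poly_Mapping.keys f. mdegree m = d)"
  have D: "D \<le> mdegree m" if "m \<in> Poly_Mapping.keys f" for m
    unfolding D_def using that by (intro Least_le) blast
  have "Poly_Mapping.keys (initial_form f) \<subseteq> Poly_Mapping.keys f"
    by (auto simp: in_keys_iff lookup_initial_form split: if_splits)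
  then have "Polynomial.coeff (tangent_hom n (initial_form f)) w = (\<Sum>m\<in>Poly_Mapping.keys f.
      if maximal_degree n m \<and> weight n m = w \<and> mdegree m = D then Poly_Mapping.lookup f m else 0)"
    (is "_ = ?s")
    by (subst coeff_tangent_hom[of "Poly_Mapping.keys f"])
       (auto simp: lookup_initial_form D_def[symmetric] intro!: sum.cong)
  also have "\<dots> = 0"
  proof (cases "\<exists>m0\<in>Poly_Mapping.keys f. maximal_degree n m0 \<and> weight n m0 = w \<and> mdegree m0 = D")
    case True
    then obtain m0 where m0: "m0 \<in> Poly_Mapping.keys f" "maximal_degree n m0" "weight n m0 = w" "mdegree m0 = D" by blast
    have "maximal_degree n m \<and> weight n m = w \<and> mdegree m = D \<longleftrightarrow> weight n m = w" if "m \<in> Poly_Mapping.keys f" for m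
      using D[OF that] m0 maximal_degree_cong[OF m0(2), of m]
      by (auto simp: maximal_degree_def intro: order.antisym)
    then have "?s = Polynomial.coeff (curve_hom n f) w"
      unfolding coeff_curve_hom by (intro sum.cong) auto
    then show ?thesis using assms by simp
  next
    case False
    then show ?thesis by (intro sum.neutral) auto
  qed
  finally show "Polynomial.coeff (tangent_hom n (initial_form f)) w = Polynomial.coeff 0 w" by simp
qed

text \<open>
  Whether multiplication by a monomial \<open>a\<close> keeps a monomial of maximal degree maximal depends on
  its weight only. So each coefficient of the image of \<open>a * f\<close> is either zero or a coefficient of the
  image of \<open>f\<close>.
\<close>

lemma tangent_hom_mult_eq_0:
  assumes "tangent_hom n f = 0"
  shows "tangent_hom n (g * f) = 0"
proof (induction g rule: mpoly_induct)
  case (single a c)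
  have "lin_ext (\<lambda>m. if maximal_degree n (a + m) then Polynomial.monom 1 (weight n (a + m)) else 0) f = 0"
    (is "lin_ext ?\<phi> f = 0")
  proof (rule poly_eqI)
    fix w
    have eq: "Polynomial.coeff (lin_ext ?\<phi> f) w = (\<Sum>m\<in>Poly_Mapping.keys f.
      if maximal_degree n (a + m) \<and> weight n (a + m) = w then Poly_Mapping.lookup f m else 0)"
      by (auto simp: coeff_lin_ext intro!: sum.cong)
    show "Polynomial.coeff (lin_ext ?\<phi> f) w = Polynomial.coeff 0 w"
    proof (cases "\<exists>m0. maximal_degree n (a + m0) \<and> weight n (a + m0) = w")
      case True
      then obtain m0 where m0: "maximal_degree n (a + m0)" "weight n (a + m0) = w" by blast
      have "maximal_degree n (a + m) \<and> weight n (a + m) = w \<longleftrightarrow>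
          maximal_degree n m \<and> weight n m = weight n m0" for m
        using maximal_degree_cong[OF m0(1), of "a + m"]
          maximal_degree_cong[OF maximal_degree_addD[OF m0(1)], of m] m0(2) by auto
      then have "Polynomial.coeff (lin_ext ?\<phi> f) w = Polynomial.coeff (tangent_hom n f) (weight n m0)"
        by (simp add: eq coeff_tangent_hom[of "Poly_Mapping.keys f"])
      then show ?thesis using assms by simp
    next
      case False
      then have "\<not> (maximal_degree n (a + m) \<and> weight n (a + m) = w)" for m by blast
      then show ?thesis unfolding eq by (simp only: if_False) simp
    qed
  qed
  then show ?case by (simp add: tangent_hom_def lin_ext_single_mult)
next
  case (add g h)
  then show ?case by (simp add: tangent_hom_def distrib_right lin_ext_add)
qed

lemma tangent_hom_add: "tangent_hom n (f + g) = tangent_hom n f + tangent_hom n g"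
  by (simp add: tangent_hom_def lin_ext_add)

lemma tangent_hom_zero: "tangent_hom n 0 = 0"
  by (simp add: tangent_hom_def)

lemma tangent_hom_kernel_ideal: "ideal {f. tangent_hom n f = 0} ring_of_type_algebra"
  unfolding ideal_type_ring_iff
  by (simp add: tangent_hom_mult_eq_0 tangent_hom_add tangent_hom_zero)

lemma poly_sum_single_add:
  fixes r :: "nat \<Rightarrow> 'm" and p q :: "'k::comm_ring_1 poly"
  defines "\<rho> \<equiv> \<lambda>p. \<Sum>i\<le>Polynomial.degree p. Poly_Mapping.single (r i) (Polynomial.coeff p i)"
  shows "\<rho> (p + q) = \<rho> p + \<rho> q"
proof -
  define N where "N = max (Polynomial.degree p) (Polynomial.degree q)"
  have *: "\<rho> u = (\<Sum>i\<le>N. Poly_Mapping.single (r i) (Polynomial.coeff u i))" if "Polynomial.degree u \<le> N" for u :: "'k poly"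
    unfolding \<rho>_def using that by (intro sum.mono_neutral_left) (auto simp: coeff_eq_0)
  have "Polynomial.degree (p + q) \<le> N" "Polynomial.degree p \<le> N" "Polynomial.degree q \<le> N"
    unfolding N_def using degree_add_le_max by auto
  then show ?thesis by (simp add: * single_add sum.distrib)
qed

text \<open>
  For \<open>\<supseteq>\<close>, subtract elements of the initial ideal until one chosen monomial \<open>r w\<close> of maximal degree is left
  in each weight \<open>w\<close>. A monomial whose degree is not maximal is the initial form of its difference
  to a monomial of the same weight and larger degree; for two monomials of equal weight and maximal
  degree, the difference is homogeneous and its own initial form. What remains of \<open>f\<close> is determined by
  \<open>tangent_hom n f\<close>.
\<close>

theorem initial_ideal_curve_ideal:
  fixes n :: "'v::finite \<Rightarrow> nat"
  assumes pos: "\<forall>i. 0 < n i"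
  shows "initial_ideal (curve_ideal n :: ('v, 'k::comm_ring_1) mpoly set) = {f. tangent_hom n f = 0}"
proof
  interpret cring "ring_of_type_algebra :: ('v, 'k) mpoly ring" by (rule cring_from_type_algebra)
  let ?J = "initial_ideal (curve_ideal n :: ('v, 'k) mpoly set)"
  show "?J \<subseteq> {f. tangent_hom n f = 0}"
    unfolding initial_ideal_def
    by (intro genideal_minimal tangent_hom_kernel_ideal)
       (auto simp: curve_ideal_def tangent_hom_initial_form)
  have "ideal ?J ring_of_type_algebra" unfolding initial_ideal_def by (intro genideal_ideal) simp
  then have zero: "0 \<in> ?J" and J_add: "\<And>f g. f \<in> ?J \<Longrightarrow> g \<in> ?J \<Longrightarrow> f + g \<in> ?J"
    unfolding ideal_type_ring_iff by auto
  have init: "initial_form f \<in> ?J" if "curve_hom n f = 0" for f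
  proof -
    have "initial_form ` curve_ideal n \<subseteq> ?J"
      unfolding initial_ideal_def by (intro genideal_self) simp
    then show ?thesis using that by (auto simp: curve_ideal_def)
  qed
  have bin: "curve_hom n (Poly_Mapping.single m c - Poly_Mapping.single m' c) = 0"
    if "weight n m = weight n m'" for m m' and c :: 'k
    using that by (simp add: curve_hom_eq_lin_ext lin_ext_diff)
  \<comment> \<open>The value is irrelevant for a number \<open>w\<close> that is not the weight of a monomial.\<close>
  define r where "r w = (SOME m. weight n m = w \<and> maximal_degree n m)" for w
  have r: "weight n (r w) = w \<and> maximal_degree n (r w)" if "weight n m = w" for m w
    unfolding r_def using someI_ex[OF exists_maximal_degree[OF pos, of m]] that by simp
  define \<rho> where "\<rho> p = (\<Sum>i\<le>Polynomial.degree p. Poly_Mapping.single (r i) (Polynomial.coeff p i))" for p :: "'k poly"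
  have normal: "f - \<rho> (tangent_hom n f) \<in> ?J" for f
  proof (induction f rule: mpoly_induct)
    case (single m c)
    show ?case
    proof (cases "maximal_degree n m")
      case True
      have rm: "weight n (r (weight n m)) = weight n m" "maximal_degree n (r (weight n m))" using r by auto
      have md: "mdegree (r (weight n m)) = mdegree m" using maximal_degree_cong[OF True rm(1)] rm(2) by simp
      have "\<rho> (Polynomial.monom c (weight n m)) = Poly_Mapping.single (r (weight n m)) c"
      proof (cases "c = 0")
        case False
        have "\<rho> (Polynomial.monom c (weight n m)) =
            (\<Sum>i\<le>weight n m. if i = weight n m then Poly_Mapping.single (r i) c else 0)"
          unfolding \<rho>_def using False by (intro sum.cong) (auto simp: degree_monom_eq)
        then show ?thesis by simp
      qed (simp add: \<rho>_def)
      then have e: "Poly_Mapping.single m c - \<rho> (tangent_hom n (Poly_Mapping.single m c))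
          = Poly_Mapping.single m c - Poly_Mapping.single (r (weight n m)) c" (is "_ = ?b")
        using True by (simp add: tangent_hom_def smult_monom)
      have "initial_form ?b = ?b"
        using keys_diff[of "Poly_Mapping.single m c" "Poly_Mapping.single (r (weight n m)) c"] md
        by (intro initial_form_homogeneous[of _ "mdegree m"]) (auto split: if_splits)
      then show ?thesis unfolding e using init[OF bin[of m "r (weight n m)" c]] rm by simp
    next
      case False
      then obtain m' where m': "weight n m' = weight n m" "mdegree m < mdegree m'"
        unfolding maximal_degree_def by (auto simp: not_le)
      have "Poly_Mapping.single m c \<in> ?J"
      proof (cases "c = 0")
        case False
        then show ?thesis using init[OF bin[of m m' c]] initial_form_binomial[OF m'(2) False] m'(1) by simp
      qed (simp add: zero)
      then show ?thesis using False by (simp add: tangent_hom_def \<rho>_def)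
    qed
  next
    case (add f g)
    have "f + g - \<rho> (tangent_hom n (f + g)) = (f - \<rho> (tangent_hom n f)) + (g - \<rho> (tangent_hom n g))"
      unfolding tangent_hom_add \<rho>_def poly_sum_single_add by simp
    then show ?case using J_add[OF add.IH] by metis
  qed
  show "{f. tangent_hom n f = 0} \<subseteq> ?J"
  proof clarify
    fix f assume "tangent_hom n f = (0 :: 'k poly)"
    then show "f \<in> ?J" using normal[of f] by (simp add: \<rho>_def)
  qed
qed

section \<open>Cohen-Macaulay tangent cones of monomial curves\<close>

definition subst_var :: "'v \<Rightarrow> 'k::comm_ring_1 poly \<Rightarrow> ('v, 'k) mpoly" where
  "subst_var v p = poly (map_poly (Poly_Mapping.single 0) p) (Var v)"

lemma subst_var_zero [simp]: "subst_var v 0 = 0"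
  by (simp add: subst_var_def)

lemma subst_var_pCons: "subst_var v (pCons a p) = Poly_Mapping.single 0 a + Var v * subst_var v p"
  by (cases "a = 0 \<and> p = 0") (auto simp: subst_var_def map_poly_pCons)

lemma subst_var_add: "subst_var v (p + q) = subst_var v p + subst_var v q"
proof -
  have "map_poly (Poly_Mapping.single 0) (p + q) =
      map_poly (Poly_Mapping.single 0) p + map_poly (Poly_Mapping.single (0 :: 'a \<Rightarrow>\<^sub>0 nat)) q"
    by (rule poly_eqI) (simp add: coeff_map_poly single_add)
  then show ?thesis by (simp add: subst_var_def)
qed

lemma subst_var_smult: "subst_var v (Polynomial.smult c p) = Poly_Mapping.single 0 c * subst_var v p"
  by (induction p) (simp_all add: subst_var_pCons mult_single distrib_left mult_ac)

lemma subst_var_mult: "subst_var v (p * q) = subst_var v p * subst_var v q"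
  by (induction p) (simp_all add: mult_pCons_left subst_var_add subst_var_smult subst_var_pCons algebra_simps)

lemma subst_var_one [simp]: "subst_var v 1 = 1"
  using subst_var_pCons[of v 1 0] by (simp flip: one_pCons)

lemma subst_var_power: "subst_var v (p ^ k) = subst_var v p ^ k"
  by (induction k) (simp_all add: subst_var_mult)

lemma subst_var_monom: "subst_var v (Polynomial.monom c k) = Poly_Mapping.single (Poly_Mapping.single v k) c"
  by (induction k) (simp_all add: monom_Suc monom_0 subst_var_pCons Var_def mult_single flip: single_add)

text \<open>
  The factor \<open>x\<^sub>v ^ k\<close> is what the induction over \<open>p\<close> needs, as it passes from \<open>a + x\<^sub>v * p\<close> to \<open>p\<close>; only the
  case \<open>k = 0\<close> is of interest.
\<close>

lemma tangent_hom_power_mult_subst_var: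
  assumes axis: "\<And>k. maximal_degree n (Poly_Mapping.single v k)"
  shows "tangent_hom n (Poly_Mapping.single (Poly_Mapping.single v k) 1 * subst_var v p) =
    Polynomial.monom 1 (k * n v) * pcompose p (Polynomial.monom 1 (n v))"
proof (induction p arbitrary: k)
  case (pCons a p)
  have "Poly_Mapping.single (Poly_Mapping.single v k) 1 * subst_var v (pCons a p) =
      Poly_Mapping.single (Poly_Mapping.single v k) a +
      Poly_Mapping.single (Poly_Mapping.single v (Suc k)) 1 * subst_var v p"
    by (simp add: subst_var_pCons distrib_left mult_single Var_def single_add[symmetric] flip: mult.assoc)
  then have "tangent_hom n (Poly_Mapping.single (Poly_Mapping.single v k) 1 * subst_var v (pCons a p)) =
      Polynomial.smult a (Polynomial.monom 1 (k * n v)) +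
      Polynomial.monom 1 (Suc k * n v) * pcompose p (Polynomial.monom 1 (n v))"
    by (simp only: tangent_hom_add pCons.IH) (simp add: tangent_hom_def axis)
  also have "\<dots> = Polynomial.monom 1 (k * n v) * pcompose (pCons a p) (Polynomial.monom 1 (n v))"
    by (simp add: pcompose_pCons distrib_left mult_monom add.commute flip: mult.assoc)
  finally show ?case .
qed (simp add: tangent_hom_zero)

lemma tangent_hom_subst_var_mult:
  assumes step: "\<And>m. maximal_degree n (Poly_Mapping.single v 1 + m) \<longleftrightarrow> maximal_degree n m"
  shows "tangent_hom n (subst_var v p * f) = pcompose p (Polynomial.monom 1 (n v)) * tangent_hom n f"
proof (induction p)
  case (pCons a p)
  have var: "tangent_hom n (Var v * g) = Polynomial.monom 1 (n v) * tangent_hom n g" for g :: "('a, 'b) mpoly"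
  proof (induction g rule: mpoly_induct)
    case (single m c)
    show ?case
      by (simp add: Var_def mult_single tangent_hom_def step[unfolded One_nat_def] mult_monom)
  next
    case (add g h)
    then show ?case by (simp add: distrib_left tangent_hom_add)
  qed
  have const: "tangent_hom n (Poly_Mapping.single 0 a * f) = Polynomial.smult a (tangent_hom n f)"
    by (simp add: tangent_hom_def lin_ext_single_mult cong: if_cong)
  have "subst_var v (pCons a p) * f = Poly_Mapping.single 0 a * f + Var v * (subst_var v p * f)"
    by (simp add: subst_var_pCons distrib_right mult.assoc)
  then show ?case
    by (simp only: tangent_hom_add var const pCons.IH)
       (simp add: pcompose_pCons distrib_right mult.assoc)
qed (simp add: tangent_hom_zero)

lemma pcompose_monom_eq_0_iff:
  fixes p :: "'k::field poly"
  assumes "0 < d"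
  shows "pcompose p (Polynomial.monom 1 d) = 0 \<longleftrightarrow> p = 0"
  using assms by (auto dest!: pcompose_eq_0 simp: degree_monom_eq)

text \<open>
  Membership in the \<open>k\<close>-th power of the ideal generated by the variables other than \<open>v\<close>.
\<close>

definition off_axis :: "'v::finite \<Rightarrow> nat \<Rightarrow> ('v, 'k::comm_ring_1) mpoly \<Rightarrow> bool" where
  "off_axis v k f \<longleftrightarrow> (\<forall>m\<in>Poly_Mapping.keys f. k \<le> (\<Sum>i\<in>UNIV - {v}. Poly_Mapping.lookup m i))"

lemma off_axis_mult:
  assumes "off_axis v k f" "off_axis v l g"
  shows "off_axis v (k + l) (f * g)"
  unfolding off_axis_def
proof
  fix m assume "m \<in> Poly_Mapping.keys (f * g)"
  then obtain a b where "a \<in> Poly_Mapping.keys f" "b \<in> Poly_Mapping.keys g" "m = a + b"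
    using keys_mult[of f g] by blast
  then show "k + l \<le> (\<Sum>i\<in>UNIV - {v}. Poly_Mapping.lookup m i)"
    using assms by (auto simp: off_axis_def lookup_add sum.distrib intro!: add_mono)
qed

lemma off_axis_power: "off_axis v 1 f \<Longrightarrow> off_axis v k (f ^ k)"
proof (induction k)
  case (Suc k)
  then show ?case using off_axis_mult[of v 1 f k "f ^ k"] by simp
qed (simp add: off_axis_def)

lemma subst_var_plus_off_axis:
  fixes f :: "('v::finite, 'k::comm_ring_1) mpoly"
  shows "\<exists>p g. f = subst_var v p + g \<and> off_axis v 1 g"
proof (induction f rule: mpoly_induct)
  case (single m c)
  show ?case
  proof (cases "\<forall>i. i \<noteq> v \<longrightarrow> Poly_Mapping.lookup m i = 0")
    case True
    then have "m = Poly_Mapping.single v (Poly_Mapping.lookup m v)"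
      by (intro poly_mapping_eqI) (auto simp: lookup_single when_def)
    then have "Poly_Mapping.single m c = subst_var v (Polynomial.monom c (Poly_Mapping.lookup m v)) + 0"
      by (simp add: subst_var_monom)
    moreover have "off_axis v 1 (0 :: ('v, 'k) mpoly)" by (simp add: off_axis_def)
    ultimately show ?thesis by blast
  next
    case False
    then obtain i where i: "i \<noteq> v" "Poly_Mapping.lookup m i \<noteq> 0" by blast
    have "Poly_Mapping.lookup m i \<le> (\<Sum>i\<in>UNIV - {v}. Poly_Mapping.lookup m i)"
      using i by (intro member_le_sum) auto
    then have "off_axis v 1 (Poly_Mapping.single m c)" using i by (simp add: off_axis_def)
    moreover have "Poly_Mapping.single m c = subst_var v 0 + Poly_Mapping.single m c" by simp
    ultimately show ?thesis by blast
  qed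
next
  case (add f g)
  then obtain p q f' g' where "f = subst_var v p + f'" "off_axis v 1 f'" "g = subst_var v q + g'" "off_axis v 1 g'"
    by blast
  moreover have "off_axis v 1 (f' + g')" using calculation(2,4) keys_add[of f' g']
    unfolding off_axis_def by blast
  moreover have "f + g = subst_var v (p + q) + (f' + g')" using calculation by (simp add: subst_var_add)
  ultimately show ?case by blast
qed

text \<open>
  A monomial curve with a strictly smallest weight \<open>n v0\<close>. Then the powers of \<open>x\<^sub>v\<^sub>0\<close> have
  maximal degree, and a power of every other variable has not.
\<close>

locale least_weight =
  fixes n :: "'v::finite \<Rightarrow> nat" and v0 :: 'v
  assumes pos: "0 < n v0" and less: "v \<noteq> v0 \<Longrightarrow> n v0 < n v"
begin

lemma all_pos: "\<forall>i. 0 < n i"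
  using pos less by (metis gr_zeroI not_less_zero)

lemma axis_maximal: "maximal_degree n (Poly_Mapping.single v0 k)"
  unfolding maximal_degree_def
proof (intro allI impI)
  fix m assume "weight n m = weight n (Poly_Mapping.single v0 k)"
  moreover have "n v0 \<le> n i" for i using less[of i] by (cases "i = v0") auto
  then have "mdegree m * n v0 \<le> weight n m"
    unfolding mdegree_def weight_def sum_distrib_right by (intro sum_mono mult_left_mono) auto
  ultimately show "mdegree m \<le> mdegree (Poly_Mapping.single v0 k)" using pos by simp
qed

text \<open>
  Replacing \<open>x\<^sub>v ^ n\<^sub>v\<^sub>0\<close> by \<open>x\<^sub>v\<^sub>0 ^ n\<^sub>v\<close> keeps the weight and raises the degree.
\<close>

lemma not_maximal_degree_if_high_power:
  assumes "v \<noteq> v0" "n v0 \<le> Poly_Mapping.lookup m v"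
  shows "\<not> maximal_degree n m"
proof
  assume max: "maximal_degree n m"
  define u where "u = m - Poly_Mapping.single v (n v0)"
  have m: "m = u + Poly_Mapping.single v (n v0)"
    using assms(2) by (intro poly_mapping_eqI)
      (auto simp: u_def lookup_add lookup_minus lookup_single when_def)
  have "weight n (u + Poly_Mapping.single v0 (n v)) = weight n m" by (simp add: m)
  then have "mdegree (u + Poly_Mapping.single v0 (n v)) \<le> mdegree m"
    using max by (simp only: maximal_degree_def)
  then show False using less[OF assms(1)] by (simp add: m)
qed

text \<open>
  By the pigeonhole principle some variable other than \<open>x\<^sub>v\<^sub>0\<close> has an exponent of at least \<open>n v0\<close>.
\<close>

lemma not_maximal_degree_if_far_off_axis:
  assumes "n v0 * CARD('v) \<le> (\<Sum>i\<in>UNIV - {v0}. Poly_Mapping.lookup m i)"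
  shows "\<not> maximal_degree n m"
proof -
  have "\<exists>v. v \<noteq> v0 \<and> n v0 \<le> Poly_Mapping.lookup m v"
  proof (rule ccontr)
    assume "\<not> ?thesis"
    then have "(\<Sum>i\<in>UNIV - {v0}. Poly_Mapping.lookup m i) \<le> (\<Sum>i\<in>UNIV - {v0}. n v0)"
      by (intro sum_mono) (auto simp: not_le less_imp_le)
    also have "\<dots> < n v0 * CARD('v)" using pos by (simp add: card_Diff_singleton)
    finally show False using assms by simp
  qed
  then show ?thesis using not_maximal_degree_if_high_power by blast
qed

lemma tangent_hom_off_axis:
  assumes "off_axis v0 (n v0 * CARD('v)) f"
  shows "tangent_hom n f = 0"
  unfolding tangent_hom_def lin_ext_def
  using assms not_maximal_degree_if_far_off_axis by (intro sum.neutral) (auto simp: off_axis_def)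

abbreviation cone :: "'k::field itself \<Rightarrow> ('v, 'k) mpoly set ring" where
  "cone _ \<equiv> ring_of_type_algebra Quot initial_ideal (curve_ideal n)"

abbreviation proj :: "('v, 'k::field) mpoly \<Rightarrow> ('v, 'k) mpoly set" where
  "proj f \<equiv> initial_ideal (curve_ideal n) +>\<^bsub>ring_of_type_algebra\<^esub> f"

lemma ideal_initial: "ideal (initial_ideal (curve_ideal n :: ('v, 'k::field) mpoly set)) ring_of_type_algebra"
  unfolding initial_ideal_curve_ideal[OF all_pos] by (rule tangent_hom_kernel_ideal)

lemma cring_cone: "cring (cone TYPE('k::field))"
  using ideal.quotient_is_cring[OF ideal_initial cring_from_type_algebra] .

lemma proj_hom: "ring_hom_cring ring_of_type_algebra (cone TYPE('k::field)) proj"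
  using ideal.rcos_ring_hom_cring[OF ideal_initial cring_from_type_algebra] .

lemma carrier_cone: "carrier (cone TYPE('k::field)) = range proj"
  by (auto simp: FactRing_def A_RCOSETS_def')

lemma proj_eq_zero_iff: "proj f = \<zero>\<^bsub>cone TYPE('k::field)\<^esub> \<longleftrightarrow> tangent_hom n f = 0"
proof -
  interpret I: ideal "initial_ideal (curve_ideal n :: ('v, 'k) mpoly set)" "ring_of_type_algebra"
    by (rule ideal_initial)
  have "proj f = initial_ideal (curve_ideal n) \<longleftrightarrow> f \<in> initial_ideal (curve_ideal n)"
    using I.a_rcos_self[of f] I.a_rcos_const[of f] by auto
  then show ?thesis by (simp add: FactRing_def initial_ideal_curve_ideal[OF all_pos])
qed

lemma
  fixes f g :: "('v, 'k::field) mpoly"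
  shows proj_add: "proj (f + g) = proj f \<oplus>\<^bsub>cone TYPE('k)\<^esub> proj g"
    and proj_mult: "proj (f * g) = proj f \<otimes>\<^bsub>cone TYPE('k)\<^esub> proj g"
    and proj_one: "proj 1 = \<one>\<^bsub>cone TYPE('k)\<^esub>"
    and proj_diff: "proj (f - g) = proj f \<ominus>\<^bsub>cone TYPE('k)\<^esub> proj g"
    and proj_power: "proj (f ^ k) = proj f [^]\<^bsub>cone TYPE('k)\<^esub> k"
proof -
  interpret h: ring_hom_cring ring_of_type_algebra "cone TYPE('k)" proj by (rule proj_hom)
  show add: "proj (f + g) = proj f \<oplus>\<^bsub>cone TYPE('k)\<^esub> proj g" for f g using h.hom_add[of f g] by simp
  show mult: "proj (f * g) = proj f \<otimes>\<^bsub>cone TYPE('k)\<^esub> proj g" for f g using h.hom_mult[of f g] by simp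
  show one: "proj 1 = \<one>\<^bsub>cone TYPE('k)\<^esub>" using h.hom_one by simp
  have "proj f = proj (f - g) \<oplus>\<^bsub>cone TYPE('k)\<^esub> proj g" using add[of "f - g" g] by simp
  then show "proj (f - g) = proj f \<ominus>\<^bsub>cone TYPE('k)\<^esub> proj g"
    using h.hom_closed[of "f - g"] h.hom_closed[of g] by (simp add: h.S.minus_eq h.S.a_assoc h.S.r_neg)
  show "proj (f ^ k) = proj f [^]\<^bsub>cone TYPE('k)\<^esub> k"
    by (induction k) (simp_all add: mult one mult.commute[of f])
qed

lemma line_algebra_cone: "line_algebra (cone TYPE('k::field)) (\<lambda>p. proj (subst_var v0 p))"
proof -
  interpret cring "cone TYPE('k)" by (rule cring_cone)
  show ?thesis
    by unfold_locales (simp_all add: carrier_cone subst_var_add subst_var_mult proj_add proj_mult proj_one)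
qed

text \<open>
  The part of a polynomial in which other variables than \<open>x\<^sub>v\<^sub>0\<close> occur is nilpotent in the tangent cone. The
  map \<open>tangent_hom n\<close> sends a polynomial \<open>p\<close> in \<open>x\<^sub>v\<^sub>0\<close> to \<open>p (t ^ n v0)\<close>, which vanishes only for \<open>p = 0\<close>.
\<close>

lemma thickened_line_cone: "thickened_line (cone TYPE('k::field)) (\<lambda>p. proj (subst_var v0 p))"
proof -
  interpret line_algebra "cone TYPE('k)" "\<lambda>p. proj (subst_var v0 p)" by (rule line_algebra_cone)
  show ?thesis
  proof
    fix a assume "a \<in> carrier (cone TYPE('k))"
    then obtain f where a: "a = proj f" by (auto simp: carrier_cone)
    obtain p g where f: "f = subst_var v0 p + g" and g: "off_axis v0 1 g" using subst_var_plus_off_axis by blast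
    have "a \<ominus>\<^bsub>cone TYPE('k)\<^esub> proj (subst_var v0 p) = proj g"
      unfolding a using proj_diff[of f "subst_var v0 p"] f by simp
    moreover have "proj (g ^ (n v0 * CARD('v))) = \<zero>\<^bsub>cone TYPE('k)\<^esub>"
      unfolding proj_eq_zero_iff by (intro tangent_hom_off_axis off_axis_power g)
    ultimately show "\<exists>p k. (a \<ominus>\<^bsub>cone TYPE('k)\<^esub> proj (subst_var v0 p)) [^]\<^bsub>cone TYPE('k)\<^esub> (k::nat) = \<zero>\<^bsub>cone TYPE('k)\<^esub>"
      by (metis proj_power)
  next
    fix p :: "'k poly" and k :: nat
    assume "proj (subst_var v0 p) [^]\<^bsub>cone TYPE('k)\<^esub> k = \<zero>\<^bsub>cone TYPE('k)\<^esub>"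
    then have "tangent_hom n (subst_var v0 (p ^ k)) = 0"
      by (simp add: proj_power[symmetric] proj_eq_zero_iff subst_var_power)
    then have "pcompose (p ^ k) (Polynomial.monom 1 (n v0)) = 0"
      using tangent_hom_power_mult_subst_var[of n v0 0 "p ^ k"] axis_maximal by simp
    then show "p = 0" by (simp add: pcompose_monom_eq_0_iff[OF pos])
  qed
qed

text \<open>
  Monomials in which a variable other than \<open>x\<^sub>v\<^sub>0\<close> has an exponent of at least \<open>n v0\<close> vanish in the tangent
  cone; the remaining ones are powers of \<open>x\<^sub>v\<^sub>0\<close> times finitely many monomials, so the tangent cone is a
  finite module over \<open>K[x\<^sub>v\<^sub>0]\<close>.
\<close>

lemma noetherian_cone: "noetherian_ring (cone TYPE('k::field))"
proof -
  interpret line_algebra "cone TYPE('k)" "\<lambda>p. proj (subst_var v0 p)" by (rule line_algebra_cone)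
  define E where "E = {m :: 'v \<Rightarrow>\<^sub>0 nat. \<forall>v. Poly_Mapping.lookup m v < n v0}"
  have "Poly_Mapping.lookup ` E \<subseteq> Pi\<^sub>E UNIV (\<lambda>_. {..<n v0})" by (auto simp: E_def)
  then have "finite (Poly_Mapping.lookup ` E)" by (rule finite_subset) (simp add: finite_PiE)
  then have "finite E" by (rule finite_imageD) (simp add: inj_on_def lookup_inject)
  then obtain es where es: "set es = (\<lambda>m. proj (Poly_Mapping.single m (1::'k))) ` E"
    using finite_list[of "(\<lambda>m. proj (Poly_Mapping.single m (1::'k))) ` E"] by auto
  have esc: "set es \<subseteq> carrier (cone TYPE('k))" by (auto simp: es carrier_cone)
  have "proj f \<in> span es" for f :: "('v, 'k) mpoly"
  proof (induction f rule: mpoly_induct)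
    case (single m c)
    show ?case
    proof (cases "\<exists>v. v \<noteq> v0 \<and> n v0 \<le> Poly_Mapping.lookup m v")
      case True
      then have "\<not> maximal_degree n m" using not_maximal_degree_if_high_power by blast
      then have "proj (Poly_Mapping.single m c) = \<zero>\<^bsub>cone TYPE('k)\<^esub>"
        unfolding proj_eq_zero_iff by (simp add: tangent_hom_def)
      then show ?thesis using zero_in_span[OF esc] by simp
    next
      case False
      define k where "k = Poly_Mapping.lookup m v0"
      define e where "e = m - Poly_Mapping.single v0 k"
      have m: "m = Poly_Mapping.single v0 k + e"
        by (intro poly_mapping_eqI) (auto simp: e_def k_def lookup_add lookup_minus lookup_single when_def)
      have "e \<in> E" using False pos
        by (auto simp: E_def e_def k_def lookup_minus lookup_single when_def not_le)
      then have "proj (Poly_Mapping.single e 1) \<in> set es" by (auto simp: es)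
      then have "proj (subst_var v0 (Polynomial.monom c k)) \<otimes>\<^bsub>cone TYPE('k)\<^esub> proj (Poly_Mapping.single e 1) \<in> span es"
        by (rule smult_generator_in_span[OF esc])
      moreover have "Poly_Mapping.single m c = subst_var v0 (Polynomial.monom c k) * Poly_Mapping.single e 1"
        by (simp add: m subst_var_monom mult_single)
      ultimately show ?thesis by (simp only: proj_mult)
    qed
  next
    case (add f g)
    then show ?case unfolding proj_add by (intro span_add[OF esc])
  qed
  then show ?thesis using noetherian_if_finite_module[OF esc] by (auto simp: carrier_cone)
qed

text \<open>
  If multiplication by \<open>x\<^sub>v\<^sub>0\<close> preserves maximality, then on the images under \<open>tangent_hom n\<close> a polynomial
  \<open>p\<close> in \<open>x\<^sub>v\<^sub>0\<close> acts as multiplication by \<open>p (t ^ n v0)\<close>, so it is a nonzerodivisor unless \<open>p = 0\<close>.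
  Conversely, a failure of maximality at \<open>m\<close> means that \<open>x\<^sub>v\<^sub>0\<close> annihilates the nonzero residue class of \<open>m\<close>.
\<close>

theorem cm_tangent_cone_iff:
  "cm_tangent_cone TYPE('k::field) n \<longleftrightarrow>
    (\<forall>m. maximal_degree n m \<longrightarrow> maximal_degree n (Poly_Mapping.single v0 1 + m))"
proof
  interpret thickened_line "cone TYPE('k)" "\<lambda>p. proj (subst_var v0 p)" by (rule thickened_line_cone)
  have Var: "subst_var v0 [:0, 1:] = (Var v0 :: ('v, 'k) mpoly)" by (simp add: subst_var_pCons)
  assume "cm_tangent_cone TYPE('k) n"
  then have cm: "cohen_macaulay (cone TYPE('k))" by (simp add: cm_tangent_cone_def)
  show "\<forall>m. maximal_degree n m \<longrightarrow> maximal_degree n (Poly_Mapping.single v0 1 + m)"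
  proof (intro allI impI, rule ccontr)
    fix m assume m: "maximal_degree n m" and "\<not> maximal_degree n (Poly_Mapping.single v0 1 + m)"
    then have "tangent_hom n (Var v0 * Poly_Mapping.single m (1::'k)) = 0"
      by (simp add: Var_def mult_single tangent_hom_def)
    then have "proj (subst_var v0 [:0, 1:] * Poly_Mapping.single m (1::'k)) = \<zero>\<^bsub>cone TYPE('k)\<^esub>"
      by (simp add: Var proj_eq_zero_iff)
    moreover have "proj (Poly_Mapping.single m (1::'k)) \<in> carrier (cone TYPE('k))"
      by (simp add: carrier_cone)
    ultimately have "proj (Poly_Mapping.single m (1::'k)) = \<zero>\<^bsub>cone TYPE('k)\<^esub>"
      unfolding proj_mult by (rule cohen_macaulayD[OF cm, rotated])
    then show False using m by (simp add: proj_eq_zero_iff tangent_hom_def)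
  qed
next
  interpret thickened_line "cone TYPE('k)" "\<lambda>p. proj (subst_var v0 p)" by (rule thickened_line_cone)
  assume *: "\<forall>m. maximal_degree n m \<longrightarrow> maximal_degree n (Poly_Mapping.single v0 1 + m)"
  have step: "maximal_degree n (Poly_Mapping.single v0 1 + m) \<longleftrightarrow> maximal_degree n m" for m
    using * maximal_degree_addD by blast
  have "cohen_macaulay (cone TYPE('k))"
  proof (rule cohen_macaulayI[OF noetherian_cone])
    fix p :: "'k poly" and a
    assume p: "p \<noteq> 0" and "a \<in> carrier (cone TYPE('k))"
      and 0: "proj (subst_var v0 p) \<otimes>\<^bsub>cone TYPE('k)\<^esub> a = \<zero>\<^bsub>cone TYPE('k)\<^esub>"
    then obtain f where a: "a = proj f" by (auto simp: carrier_cone)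
    have "tangent_hom n (subst_var v0 p * f) = 0"
      using 0 unfolding a proj_mult[symmetric] proj_eq_zero_iff .
    then have "tangent_hom n f = 0"
      using p pcompose_monom_eq_0_iff[OF pos, of p] by (simp add: tangent_hom_subst_var_mult[OF step])
    then show "a = \<zero>\<^bsub>cone TYPE('k)\<^esub>" by (simp add: a proj_eq_zero_iff)
  qed
  then show "cm_tangent_cone TYPE('k) n" by (simp add: cm_tangent_cone_def)
qed

end

section \<open>Monomials modulo binomials\<close>

text \<open>
  Fix \<open>m'\<close> and add up the coefficients of those monomials \<open>u\<close> of a polynomial for which \<open>P u = P m'\<close>. By
  invariance this functional vanishes on every monomial multiple of a generator, hence on the curve
  ideal, which contains the difference of \<open>m\<close> and \<open>m'\<close>.
\<close>

lemma binomial_generators_connect: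
  fixes n :: "'v::finite \<Rightarrow> nat" and P :: "('v \<Rightarrow>\<^sub>0 nat) \<Rightarrow> 'c"
  assumes gen: "genideal ring_of_type_algebra B = (curve_ideal n :: ('v, 'k::field) mpoly set)"
    and inv: "\<And>b. b \<in> B \<Longrightarrow>
      \<exists>h t. b = Poly_Mapping.single h 1 - Poly_Mapping.single t 1 \<and> (\<forall>c. P (c + h) = P (c + t))"
    and weight: "weight n m = weight n m'"
  shows "P m = P m'"
proof -
  interpret cring "ring_of_type_algebra :: ('v, 'k) mpoly ring" by (rule cring_from_type_algebra)
  \<comment> \<open>The indicator of the class of \<open>m'\<close>, as a constant polynomial.\<close>
  define \<phi> where "\<phi> u = (if P u = P m' then 1 else (0 :: 'k poly))" for u
  define L where "L = {f :: ('v, 'k) mpoly. \<forall>c. lin_ext \<phi> (Poly_Mapping.single c 1 * f) = 0}"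
  have mult: "g * f \<in> L" if f: "f \<in> L" for f g
  proof (induction g rule: mpoly_induct)
    case (single a d)
    have "lin_ext \<phi> (Poly_Mapping.single c 1 * (Poly_Mapping.single a d * f)) = 0" for c
    proof -
      have "Poly_Mapping.single c 1 * (Poly_Mapping.single a d * f) = Poly_Mapping.single (c + a) d * f"
        by (simp add: mult_single flip: mult.assoc)
      then have "lin_ext \<phi> (Poly_Mapping.single c 1 * (Poly_Mapping.single a d * f)) =
          Polynomial.smult d (lin_ext \<phi> (Poly_Mapping.single (c + a) 1 * f))"
        by (simp add: lin_ext_single_mult)
      then show ?thesis using f by (simp add: L_def)
    qed
    then show ?case by (simp add: L_def)
  next
    case (add f g)
    then show ?case by (simp add: L_def distrib_left distrib_right lin_ext_add)
  qed
  have "ideal L ring_of_type_algebra"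
    unfolding ideal_type_ring_iff using mult by (simp add: L_def distrib_left lin_ext_add)
  moreover have "B \<subseteq> L"
  proof
    fix b assume "b \<in> B"
    then obtain h t where b: "b = Poly_Mapping.single h 1 - Poly_Mapping.single t 1"
      and P: "\<And>c. P (c + h) = P (c + t)" using inv by blast
    show "b \<in> L" by (simp add: L_def b right_diff_distrib mult_single lin_ext_diff \<phi>_def P)
  qed
  ultimately have "curve_ideal n \<subseteq> L" unfolding gen[symmetric] by (rule genideal_minimal)
  moreover have "Poly_Mapping.single m 1 - Poly_Mapping.single m' 1 \<in> curve_ideal n"
    using weight by (simp add: curve_ideal_def curve_hom_eq_lin_ext lin_ext_diff)
  ultimately have "lin_ext \<phi> (Poly_Mapping.single 0 1 * (Poly_Mapping.single m 1 - Poly_Mapping.single m' 1)) = 0"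
    unfolding L_def by blast
  then have "\<phi> m = \<phi> m'" by (simp add: lin_ext_diff)
  then show ?thesis by (auto simp: \<phi>_def split: if_splits)
qed

text \<open>
  Newman's lemma, with a choice of normal form that is invariant under the relation.
\<close>

lemma unique_normal_form:
  fixes r :: "'a \<Rightarrow> 'a \<Rightarrow> bool"
  assumes wf: "wfp (\<lambda>y x. r x y)"
    and local: "\<And>x y z. r x y \<Longrightarrow> r x z \<Longrightarrow> \<exists>u. r\<^sup>*\<^sup>* y u \<and> r\<^sup>*\<^sup>* z u"
  shows "\<exists>nf. \<forall>x. r\<^sup>*\<^sup>* x (nf x) \<and> (\<forall>y. \<not> r (nf x) y) \<and> (\<forall>y. r x y \<longrightarrow> nf y = nf x)"
proof -
  have confluent: "r\<^sup>*\<^sup>* x y \<Longrightarrow> r\<^sup>*\<^sup>* x z \<Longrightarrow> \<exists>u. r\<^sup>*\<^sup>* y u \<and> r\<^sup>*\<^sup>* z u" for x y z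
  proof (induction x arbitrary: y z rule: wfp_induct_rule[OF wf])
    case (1 x)
    show ?case
    proof (cases "x = y \<or> x = z")
      case True
      then show ?thesis using 1 by blast
    next
      case False
      then obtain y' z' where y': "r x y'" "r\<^sup>*\<^sup>* y' y" and z': "r x z'" "r\<^sup>*\<^sup>* z' z"
        using 1(2,3) by (metis converse_rtranclpE)
      obtain v where v: "r\<^sup>*\<^sup>* y' v" "r\<^sup>*\<^sup>* z' v" using local y'(1) z'(1) by blast
      obtain s where s: "r\<^sup>*\<^sup>* y s" "r\<^sup>*\<^sup>* v s" using 1(1) y' v(1) by blast
      have "r\<^sup>*\<^sup>* z' s" using v(2) s(2) by (rule rtranclp_trans)
      then obtain t where "r\<^sup>*\<^sup>* s t" "r\<^sup>*\<^sup>* z t" using 1(1) z' by blast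
      then show ?thesis using s(1) by (meson rtranclp_trans)
    qed
  qed
  have "\<exists>u. r\<^sup>*\<^sup>* x u \<and> (\<forall>y. \<not> r u y)" for x
  proof (induction x rule: wfp_induct_rule[OF wf])
    case (1 x)
    then show ?case by (metis converse_rtranclp_into_rtranclp rtranclp.rtrancl_refl)
  qed
  then obtain nf where nf: "\<And>x. r\<^sup>*\<^sup>* x (nf x)" "\<And>x y. \<not> r (nf x) y" by metis
  have "nf y = nf x" if "r x y" for x y
  proof -
    have "r\<^sup>*\<^sup>* x (nf y)" using that nf(1) by (meson converse_rtranclp_into_rtranclp)
    then obtain u where "r\<^sup>*\<^sup>* (nf y) u" "r\<^sup>*\<^sup>* (nf x) u" using confluent nf(1) by blast
    then show ?thesis using nf(2) by (metis converse_rtranclpE)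
  qed
  then show ?thesis using nf by blast
qed

section \<open>Rewriting with the five binomials\<close>

locale exponents =
  fixes a13 a14 a21 a24 a31 a32 a42 a43 :: nat
begin

text \<open>
  Exponent vectors of the five binomials, each read from the monomial without \<open>x\<^sub>1\<close> to the other one.
\<close>

inductive move :: "nat \<Rightarrow> nat \<times> nat \<times> nat \<times> nat \<Rightarrow> nat \<times> nat \<times> nat \<times> nat \<Rightarrow> bool" where
  m1: "move 1 (p, q, r + a13, s + a14) (p + (a21 + a31), q, r, s)"
| m2: "move 2 (p, q + (a32 + a42), r, s) (p + a21, q, r, s + a24)"
| m3: "move 3 (p, q, r + (a13 + a43), s) (p + a31, q + a32, r, s)"
| m4: "move 4 (p, q, r, s + (a14 + a24)) (p, q + a42, r + a43, s)"
| m5: "move 5 (p, q + a32, r, s + a14) (p + a21, q, r + a43, s)"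

definition step :: "nat \<times> nat \<times> nat \<times> nat \<Rightarrow> nat \<times> nat \<times> nat \<times> nat \<Rightarrow> bool" where
  "step x y \<longleftrightarrow> (\<exists>k. move k x y)"

lemma step_eqI:
  "move k x y \<Longrightarrow> x' = x \<Longrightarrow> y' = y \<Longrightarrow> step x' y'"
  by (auto simp: step_def)

definition joinable where
  "joinable y z \<longleftrightarrow> (\<exists>u. step\<^sup>*\<^sup>* y u \<and> step\<^sup>*\<^sup>* z u)"

lemma joinable_step: "step y z \<Longrightarrow> joinable y z" "step z y \<Longrightarrow> joinable y z"
  "step y u \<Longrightarrow> step z u \<Longrightarrow> joinable y z"  "step z u \<Longrightarrow> step u y \<Longrightarrow> joinable y z"
  unfolding joinable_def by (meson r_into_rtranclp rtranclp.rtrancl_refl rtranclp.rtrancl_into_rtrancl)+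

text \<open>
  Two moves whose monomials are coprime commute. In the remaining pairs a third move closes the
  diagram: for example, \<open>x\<^sub>3 ^ a\<^sub>3 * x\<^sub>4 ^ a\<^sub>1\<^sub>4\<close> becomes \<open>x\<^sub>1 ^ a\<^sub>1 * x\<^sub>3 ^ a\<^sub>4\<^sub>3\<close> by move 1, and also by move 3
  followed by move 5.
\<close>

lemma move_joinable:
  assumes "move i x y" "move j x z" "i \<le> j"
  shows "joinable y z"
  using assms(1)
proof cases
  case (m1 p q r s)
  note x = this
  from assms(2) show ?thesis
  proof cases
    case (m1 p' q' r' s')
    then show ?thesis using x by (auto simp: joinable_def)
  next
    case (m2 p' q' r' s')
    show ?thesis
    proof (rule joinable_step(3))
      show "step y (p + (a21 + a31) + a21, q', r, s + a24)"
        by (rule step_eqI, rule move.m2) (use x m2 in auto)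
      show "step z (p + (a21 + a31) + a21, q', r, s + a24)"
        by (rule step_eqI, rule move.m1) (use x m2 in auto)
    qed
  next
    case (m3 p' q' r' s')
    have "step z y" by (rule step_eqI, rule move.m5) (use x m3 in auto)
    then show ?thesis by (rule joinable_step)
  next
    case (m4 p' q' r' s')
    show ?thesis
    proof (rule joinable_step(4))
      show "step z (p + a31, q + (a32 + a42), r, s')"
        by (rule step_eqI, rule move.m3) (use x m4 in auto)
      show "step (p + a31, q + (a32 + a42), r, s') y"
        by (rule step_eqI, rule move.m2) (use x m4 in auto)
    qed
  next
    case (m5 p' q' r' s')
    have "step z y" by (rule step_eqI, rule move.m3) (use x m5 in auto)
    then show ?thesis by (rule joinable_step)
  qed
next
  case (m2 p q r s)
  note x = this
  from assms(2) show ?thesis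
  proof cases
    case (m2 p' q' r' s')
    then show ?thesis using x by (auto simp: joinable_def)
  next
    case (m3 p' q' r' s')
    show ?thesis
    proof (rule joinable_step(3))
      show "step y (p + a21 + a31, q + a32, r', s + a24)"
        by (rule step_eqI, rule move.m3) (use x m3 in auto)
      show "step z (p + a21 + a31, q + a32, r', s + a24)"
        by (rule step_eqI, rule move.m2) (use x m3 in auto)
    qed
  next
    case (m4 p' q' r' s')
    show ?thesis
    proof (rule joinable_step(3))
      show "step y (p + a21, q + a42, r + a43, s' + a24)"
        by (rule step_eqI, rule move.m4) (use x m4 in auto)
      show "step z (p + a21, q + a42, r + a43, s' + a24)"
        by (rule step_eqI, rule move.m2) (use x m4 in auto)
    qed
  next
    case (m5 p' q' r' s')
    have "step y z" by (rule step_eqI, rule move.m4) (use x m5 in auto)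
    then show ?thesis by (rule joinable_step)
  qed (use x assms(3) in auto)
next
  case (m3 p q r s)
  note x = this
  from assms(2) show ?thesis
  proof cases
    case (m3 p' q' r' s')
    then show ?thesis using x by (auto simp: joinable_def)
  next
    case (m4 p' q' r' s')
    show ?thesis
    proof (rule joinable_step(3))
      show "step y (p + a31, q + a32 + a42, r + a43, s')"
        by (rule step_eqI, rule move.m4) (use x m4 in auto)
      show "step z (p + a31, q + a32 + a42, r + a43, s')"
        by (rule step_eqI, rule move.m3) (use x m4 in auto)
    qed
  next
    case (m5 p' q' r' s')
    show ?thesis
    proof (rule joinable_step(3))
      show "step y (p + a31 + a21, q' + a32, r + a43, s')"
        by (rule step_eqI, rule move.m5) (use x m5 in auto)
      show "step z (p + a31 + a21, q' + a32, r + a43, s')"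
        by (rule step_eqI, rule move.m3) (use x m5 in auto)
    qed
  qed (use x assms(3) in auto)
next
  case (m4 p q r s)
  note x = this
  from assms(2) show ?thesis
  proof cases
    case (m4 p' q' r' s')
    then show ?thesis using x by (auto simp: joinable_def)
  next
    case (m5 p' q' r' s')
    have "step y z" by (rule step_eqI, rule move.m2) (use x m5 in auto)
    then show ?thesis by (rule joinable_step)
  qed (use x assms(3) in auto)
next
  case (m5 p q r s)
  from assms(2) show ?thesis
    by cases (use m5 assms(3) in \<open>auto simp: joinable_def\<close>)
qed

lemma step_locally_confluent:
  assumes "step x y" "step x z"
  shows "\<exists>u. step\<^sup>*\<^sup>* y u \<and> step\<^sup>*\<^sup>* z u"
proof -
  obtain i j where "move i x y" "move j x z" using assms by (auto simp: step_def)
  then have "joinable y z \<or> joinable z y" using move_joinable by (metis nat_le_linear)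
  then show ?thesis unfolding joinable_def by blast
qed

text \<open>
  No move requires a factor \<open>x\<^sub>1\<close>.
\<close>

lemma step_irreducible_Suc:
  assumes "\<And>y. \<not> step (p, q, r, s) y"
  shows "\<not> step (Suc p, q, r, s) y"
proof
  assume "step (Suc p, q, r, s) y"
  then obtain k where "move k (Suc p, q, r, s) y" by (auto simp: step_def)
  moreover have "\<not> move k (p, q, r, s) y" for k y using assms by (auto simp: step_def)
  ultimately show False
    by cases (use move.m1 move.m2 move.m3 move.m4 move.m5 in metis)+
qed

end

text \<open>
  The equations \<open>rel\<close> say that the binomials are homogeneous for the weights, and \<open>deg\<close> that no move
  lowers the degree. The fourth inequality is strict because the move 4 leaves the exponent of \<open>x\<^sub>1\<close>
  unchanged, so that only the degree can witness its progress.
\<close>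

locale weighted_exponents = exponents +
  fixes w1 w2 w3 w4 :: nat
  assumes pos: "0 < w1" "0 < w2" "0 < w3" "0 < w4" and exp_pos: "0 < a21" "0 < a31"
    and rel: "(a21 + a31) * w1 = a13 * w3 + a14 * w4" "(a32 + a42) * w2 = a21 * w1 + a24 * w4"
      "(a13 + a43) * w3 = a31 * w1 + a32 * w2" "(a14 + a24) * w4 = a42 * w2 + a43 * w3"
      "a21 * w1 + a43 * w3 = a32 * w2 + a14 * w4"
    and deg: "a13 + a14 \<le> a21 + a31" "a32 + a42 \<le> a21 + a24" "a13 + a43 \<le> a31 + a32"
      "a14 + a24 < a42 + a43" "a32 + a14 \<le> a21 + a43"
begin

fun wt :: "nat \<times> nat \<times> nat \<times> nat \<Rightarrow> nat" where
  "wt (p, q, r, s) = p * w1 + q * w2 + r * w3 + s * w4"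

fun dg :: "nat \<times> nat \<times> nat \<times> nat \<Rightarrow> nat" where
  "dg (p, q, r, s) = p + q + r + s"

text \<open>
  The sum of the degree and the exponent of \<open>x\<^sub>1\<close> increases strictly. It is at most twice the weight, which
  makes the moves terminate.
\<close>

lemma step_monotone:
  assumes "step x y"
  shows "wt y = wt x" "dg x \<le> dg y" "dg x + fst x < dg y + fst y"
proof -
  have "wt y = wt x \<and> dg x \<le> dg y \<and> dg x + fst x < dg y + fst y"
    using assms unfolding step_def
  proof (elim exE move.cases, goal_cases)
    case (1 k p q r s)
    then show ?thesis using rel(1) deg(1) exp_pos by (simp add: algebra_simps)
  next
    case (2 k p q r s)
    then show ?thesis using rel(2) deg(2) exp_pos by (simp add: algebra_simps)
  next
    case (3 k p q r s)
    then show ?thesis using rel(3) deg(3) exp_pos by (simp add: algebra_simps)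
  next
    case (4 k p q r s)
    then show ?thesis using rel(4) deg(4) exp_pos by (simp add: algebra_simps)
  next
    case (5 k p q r s)
    then show ?thesis using rel(5) deg(5) exp_pos by (simp add: algebra_simps)
  qed
  then show "wt y = wt x" "dg x \<le> dg y" "dg x + fst x < dg y + fst y" by simp_all
qed

lemma steps_monotone: "step\<^sup>*\<^sup>* x y \<Longrightarrow> wt y = wt x \<and> dg x \<le> dg y"
  by (induction rule: rtranclp_induct) (use step_monotone in \<open>auto intro: order_trans\<close>)

lemma dg_le_wt: "dg x \<le> wt x"
proof (cases x)
  case (fields p q r s)
  show ?thesis unfolding fields wt.simps dg.simps
    by (intro add_mono) (use pos in \<open>simp_all add: Suc_leI\<close>)
qed

lemma step_terminates: "wfp (\<lambda>y x. step x y)"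
proof (rule wfp_if_convertible_to_nat)
  fix y x assume "step x y"
  note mono = step_monotone[OF this]
  have "fst y \<le> dg y" by (cases y) simp
  then have "dg y + fst y \<le> 2 * wt y" using dg_le_wt[of y] by simp
  then show "2 * wt y - (dg y + fst y) < 2 * wt x - (dg x + fst x)" using mono by simp
qed

text \<open>
  A normal form has at least the degree of every monomial that reduces to it, and it remains a
  normal form when it is multiplied by \<open>x\<^sub>1\<close>.
\<close>

lemma normal_forms:
  "\<exists>nf. (\<forall>x. wt (nf x) = wt x \<and> dg x \<le> dg (nf x)) \<and> (\<forall>x y. step x y \<longrightarrow> nf y = nf x) \<and>
    (\<forall>x p q r s. nf x = (p, q, r, s) \<longrightarrow> nf (Suc p, q, r, s) = (Suc p, q, r, s))"
proof -
  have "\<exists>nf. \<forall>x. step\<^sup>*\<^sup>* x (nf x) \<and> (\<forall>y. \<not> step (nf x) y) \<and> (\<forall>y. step x y \<longrightarrow> nf y = nf x)"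
    by (rule unique_normal_form[OF step_terminates step_locally_confluent])
  then obtain nf where
      "\<forall>x. step\<^sup>*\<^sup>* x (nf x) \<and> (\<forall>y. \<not> step (nf x) y) \<and> (\<forall>y. step x y \<longrightarrow> nf y = nf x)"
    by (rule exE)
  then have nf: "step\<^sup>*\<^sup>* x (nf x)" "\<not> step (nf x) y" "step x y \<Longrightarrow> nf y = nf x" for x y
    by blast+
  have "nf (Suc p, q, r, s) = (Suc p, q, r, s)" if x: "nf x = (p, q, r, s)" for x p q r s
  proof -
    have "\<not> step (p, q, r, s) y" for y using nf(2)[of x] x by simp
    then have "\<not> step (Suc p, q, r, s) y" for y by (rule step_irreducible_Suc)
    then show ?thesis using nf(1)[of "(Suc p, q, r, s)"] by (metis converse_rtranclpE)
  qed
  then show ?thesis using steps_monotone[OF nf(1)] nf(3) by blast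
qed

end

section \<open>The Gorenstein curve\<close>

lemma Var_power: "Var i ^ k = Poly_Mapping.single (Poly_Mapping.single i k) 1"
  by (induction k) (simp_all add: Var_def mult_single flip: single_add)

lemma weight_4: "weight n (m :: 4 \<Rightarrow>\<^sub>0 nat) = Poly_Mapping.lookup m 1 * n 1 + Poly_Mapping.lookup m 2 * n 2
    + Poly_Mapping.lookup m 3 * n 3 + Poly_Mapping.lookup m 4 * n 4"
  by (simp add: weight_def sum_4)

lemma mdegree_4: "mdegree (m :: 4 \<Rightarrow>\<^sub>0 nat) = Poly_Mapping.lookup m 1 + Poly_Mapping.lookup m 2
    + Poly_Mapping.lookup m 3 + Poly_Mapping.lookup m 4"
  by (simp add: mdegree_def sum_4)

definition mono4 :: "nat \<times> nat \<times> nat \<times> nat \<Rightarrow> 4 \<Rightarrow>\<^sub>0 nat" where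
  "mono4 = (\<lambda>(p, q, r, s). Poly_Mapping.single 1 p + Poly_Mapping.single 2 q +
    Poly_Mapping.single 3 r + Poly_Mapping.single 4 s)"

definition exps4 :: "(4 \<Rightarrow>\<^sub>0 nat) \<Rightarrow> nat \<times> nat \<times> nat \<times> nat" where
  "exps4 m = (Poly_Mapping.lookup m 1, Poly_Mapping.lookup m 2, Poly_Mapping.lookup m 3, Poly_Mapping.lookup m 4)"

lemma exps4_mono4 [simp]: "exps4 (mono4 x) = x"
  by (cases x) (simp add: exps4_def mono4_def lookup_add lookup_single when_def)

definition bresinsky_generators ::
  "nat \<Rightarrow> nat \<Rightarrow> nat \<Rightarrow> nat \<Rightarrow> nat \<Rightarrow> nat \<Rightarrow> nat \<Rightarrow> nat \<Rightarrow> (4, 'k::comm_ring_1) mpoly set" where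
  "bresinsky_generators a13 a14 a21 a24 a31 a32 a42 a43 =
    {Var 1 ^ (a21 + a31) - Var 3 ^ a13 * Var 4 ^ a14,
     Var 2 ^ (a32 + a42) - Var 1 ^ a21 * Var 4 ^ a24,
     Var 3 ^ (a13 + a43) - Var 1 ^ a31 * Var 2 ^ a32,
     Var 4 ^ (a14 + a24) - Var 2 ^ a42 * Var 3 ^ a43,
     Var 1 ^ a21 * Var 3 ^ a43 - Var 2 ^ a32 * Var 4 ^ a14}"

text \<open>
  The argument \<open>field_type\<close> serves to name the coefficient field.
\<close>

locale bresinsky_curve =
  fixes n :: "4 \<Rightarrow> nat" and a13 a14 a21 a24 a31 a32 a42 a43 :: nat and field_type :: "'k::field itself"
  assumes increasing: "0 < n 1" "n 1 < n 2" "n 2 < n 3" "n 3 < n 4"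
    and exp_pos: "0 < a13" "0 < a14" "0 < a21" "0 < a24" "0 < a31" "0 < a32" "0 < a42" "0 < a43"
    and generated: "genideal ring_of_type_algebra (bresinsky_generators a13 a14 a21 a24 a31 a32 a42 a43)
      = (curve_ideal n :: (4, 'k) mpoly set)"
begin

lemma connected:
  fixes P :: "(4 \<Rightarrow>\<^sub>0 nat) \<Rightarrow> 'c"
  assumes
    "\<And>c. P (c + Poly_Mapping.single 1 (a21 + a31)) = P (c + (Poly_Mapping.single 3 a13 + Poly_Mapping.single 4 a14))"
    "\<And>c. P (c + Poly_Mapping.single 2 (a32 + a42)) = P (c + (Poly_Mapping.single 1 a21 + Poly_Mapping.single 4 a24))"
    "\<And>c. P (c + Poly_Mapping.single 3 (a13 + a43)) = P (c + (Poly_Mapping.single 1 a31 + Poly_Mapping.single 2 a32))"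
    "\<And>c. P (c + Poly_Mapping.single 4 (a14 + a24)) = P (c + (Poly_Mapping.single 2 a42 + Poly_Mapping.single 3 a43))"
    "\<And>c. P (c + (Poly_Mapping.single 1 a21 + Poly_Mapping.single 3 a43)) = P (c + (Poly_Mapping.single 2 a32 + Poly_Mapping.single 4 a14))"
    and "weight n m = weight n m'"
  shows "P m = P m'"
proof (rule binomial_generators_connect[OF generated _ assms(6)])
  fix b :: "(4, 'k) mpoly"
  assume "b \<in> bresinsky_generators a13 a14 a21 a24 a31 a32 a42 a43"
  then show "\<exists>h t. b = Poly_Mapping.single h 1 - Poly_Mapping.single t 1 \<and> (\<forall>c. P (c + h) = P (c + t))"
    using assms(1-5) unfolding bresinsky_generators_def Var_power mult_single mult_1
    by (elim insertE emptyE) blast+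
qed

lemma weight_relations:
  "(a21 + a31) * n 1 = a13 * n 3 + a14 * n 4" "(a32 + a42) * n 2 = a21 * n 1 + a24 * n 4"
  "(a13 + a43) * n 3 = a31 * n 1 + a32 * n 2" "(a14 + a24) * n 4 = a42 * n 2 + a43 * n 3"
  "a21 * n 1 + a43 * n 3 = a32 * n 2 + a14 * n 4"
proof -
  interpret cring "ring_of_type_algebra :: (4, 'k) mpoly ring" by (rule cring_from_type_algebra)
  have sub: "bresinsky_generators a13 a14 a21 a24 a31 a32 a42 a43 \<subseteq> (curve_ideal n :: (4, 'k) mpoly set)"
    unfolding generated[symmetric] by (rule genideal_self) simp
  have eq: "weight n h = weight n t"
    if "Poly_Mapping.single h 1 - Poly_Mapping.single t 1 \<in> (curve_ideal n :: (4, 'k) mpoly set)" for h t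
  proof -
    have "Polynomial.monom (1::'k) (weight n h) = Polynomial.monom 1 (weight n t)"
      using that by (simp add: curve_ideal_def curve_hom_eq_lin_ext lin_ext_diff)
    then show ?thesis by (metis degree_monom_eq one_neq_zero)
  qed
  from sub show "(a21 + a31) * n 1 = a13 * n 3 + a14 * n 4" "(a32 + a42) * n 2 = a21 * n 1 + a24 * n 4"
    "(a13 + a43) * n 3 = a31 * n 1 + a32 * n 2" "(a14 + a24) * n 4 = a42 * n 2 + a43 * n 3"
    "a21 * n 1 + a43 * n 3 = a32 * n 2 + a14 * n 4"
    unfolding bresinsky_generators_def Var_power mult_single mult_1
    by (auto dest!: eq)
qed

lemma least_weight_1: "least_weight n 1"
proof
  fix v :: 4 assume "v \<noteq> 1"
  then show "n 1 < n v" using exhaust_4[of v] increasing by auto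
qed (use increasing in simp)

lemma degree_inequalities:
  "a13 + a14 < a21 + a31" "a13 + a43 < a31 + a32" "a14 + a24 < a42 + a43"
proof -
  have "(a13 + a14) * n 1 < a13 * n 3 + a14 * n 4"
    unfolding distrib_right using exp_pos increasing by (intro add_strict_mono mult_strict_left_mono) auto
  then show "a13 + a14 < a21 + a31" unfolding weight_relations(1)[symmetric] by simp
  have "a31 * n 1 + a32 * n 2 < (a31 + a32) * n 3"
    unfolding distrib_right using exp_pos increasing by (intro add_strict_mono mult_strict_left_mono) auto
  then show "a13 + a43 < a31 + a32" unfolding weight_relations(3)[symmetric] by simp
  have "a42 * n 2 + a43 * n 3 < (a42 + a43) * n 4"
    unfolding distrib_right using exp_pos increasing by (intro add_strict_mono mult_strict_left_mono) auto
  then show "a14 + a24 < a42 + a43" unfolding weight_relations(4)[symmetric] by simp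
qed

text \<open>
  Let \<open>v\<close> be the normal form of \<open>m\<close>. The monomial \<open>x\<^sub>1 * v\<close> is a normal form, hence the normal form of every
  monomial of the weight of \<open>x\<^sub>1 * m\<close>, and its degree bounds theirs. But \<open>v\<close> has at most the degree
  of \<open>m\<close>.
\<close>

lemma maximal_degree_Suc:
  assumes le: "a32 + a42 \<le> a21 + a24" and max: "maximal_degree n m"
  shows "maximal_degree n (Poly_Mapping.single 1 1 + m)"
proof -
  interpret weighted_exponents a13 a14 a21 a24 a31 a32 a42 a43 "n 1" "n 2" "n 3" "n 4"
    using increasing exp_pos weight_relations degree_inequalities le
    by unfold_locales linarith+
  obtain nf where "\<forall>x. wt (nf x) = wt x \<and> dg x \<le> dg (nf x)"
    "\<forall>x y. step x y \<longrightarrow> nf y = nf x"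
    "\<forall>x p q r s. nf x = (p, q, r, s) \<longrightarrow> nf (Suc p, q, r, s) = (Suc p, q, r, s)"
    using normal_forms by (elim exE conjE)
  then have nf: "wt (nf x) = wt x" "dg x \<le> dg (nf x)" "step x y \<Longrightarrow> nf y = nf x"
    "nf x = (p, q, r, s) \<Longrightarrow> nf (Suc p, q, r, s) = (Suc p, q, r, s)" for x y p q r s
    by blast+
  have weight: "weight n u = wt (exps4 u)" and deg: "mdegree u = dg (exps4 u)" for u
    by (simp_all add: weight_4 mdegree_4 exps4_def)
  have nf_eq: "nf (exps4 u) = nf (exps4 u')" if "weight n u = weight n u'" for u u'
  proof (rule connected[where P = "\<lambda>u. nf (exps4 u)", OF _ _ _ _ _ that])
    fix c
    obtain p q r s where c: "exps4 c = (p, q, r, s)" by (cases "exps4 c")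
    then have l: "Poly_Mapping.lookup c 1 = p" "Poly_Mapping.lookup c 2 = q"
      "Poly_Mapping.lookup c 3 = r" "Poly_Mapping.lookup c 4 = s" by (simp_all add: exps4_def)
    note simps = exps4_def lookup_add lookup_single l when_def
    show "nf (exps4 (c + Poly_Mapping.single 1 (a21 + a31))) =
        nf (exps4 (c + (Poly_Mapping.single 3 a13 + Poly_Mapping.single 4 a14)))"
      by (rule nf(3), rule step_eqI, rule m1[of p q r s]) (simp_all add: simps)
    show "nf (exps4 (c + Poly_Mapping.single 2 (a32 + a42))) =
        nf (exps4 (c + (Poly_Mapping.single 1 a21 + Poly_Mapping.single 4 a24)))"
      by (rule nf(3)[symmetric], rule step_eqI, rule m2[of p q r s]) (simp_all add: simps)
    show "nf (exps4 (c + Poly_Mapping.single 3 (a13 + a43))) =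
        nf (exps4 (c + (Poly_Mapping.single 1 a31 + Poly_Mapping.single 2 a32)))"
      by (rule nf(3)[symmetric], rule step_eqI, rule m3[of p q r s]) (simp_all add: simps)
    show "nf (exps4 (c + Poly_Mapping.single 4 (a14 + a24))) =
        nf (exps4 (c + (Poly_Mapping.single 2 a42 + Poly_Mapping.single 3 a43)))"
      by (rule nf(3)[symmetric], rule step_eqI, rule m4[of p q r s]) (simp_all add: simps)
    show "nf (exps4 (c + (Poly_Mapping.single 1 a21 + Poly_Mapping.single 3 a43))) =
        nf (exps4 (c + (Poly_Mapping.single 2 a32 + Poly_Mapping.single 4 a14)))"
      by (rule nf(3), rule step_eqI, rule m5[of p q r s]) (simp_all add: simps)
  qed
  show ?thesis
    unfolding maximal_degree_def
  proof (intro allI impI)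
    fix m' assume w: "weight n m' = weight n (Poly_Mapping.single 1 1 + m)"
    obtain p q r s where v: "nf (exps4 m) = (p, q, r, s)" by (cases "nf (exps4 m)")
    have wv: "wt (p, q, r, s) = weight n m" using nf(1)[of "exps4 m"] by (simp only: v weight)
    have "weight n m' = weight n (mono4 (Suc p, q, r, s))"
      using w wv by (simp add: weight[of "mono4 _"])
    then have "nf (exps4 m') = nf (Suc p, q, r, s)" using nf_eq by (metis exps4_mono4)
    also have "\<dots> = (Suc p, q, r, s)" by (rule nf(4)[OF v])
    finally have "mdegree m' \<le> dg (Suc p, q, r, s)" using nf(2)[of "exps4 m'"] deg by metis
    also have "\<dots> = Suc (mdegree (mono4 (p, q, r, s)))" by (simp add: deg)
    also have "mdegree (mono4 (p, q, r, s)) \<le> mdegree m"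
      using max wv unfolding maximal_degree_def by (metis exps4_mono4 weight)
    finally show "mdegree m' \<le> mdegree (Poly_Mapping.single 1 1 + m)" by simp
  qed
qed

text \<open>
  No monomial of a generator divides \<open>x\<^sub>4 ^ k\<close>, so it is the only monomial of its weight.
\<close>

lemma maximal_degree_x4_power:
  assumes "k < a14 + a24"
  shows "maximal_degree n (Poly_Mapping.single 4 k)"
  unfolding maximal_degree_def
proof (intro allI impI)
  fix m assume "weight n m = weight n (Poly_Mapping.single 4 k)"
  then have "(exps4 m = (0, 0, 0, k)) = (exps4 (Poly_Mapping.single 4 k) = (0, 0, 0, k))"
    by (rule connected[where P = "\<lambda>u. exps4 u = (0, 0, 0, k)", rotated 5])
       (use exp_pos assms in \<open>auto simp: exps4_def lookup_add lookup_single when_def\<close>)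
  then have "exps4 m = (0, 0, 0, k)" by (simp add: exps4_def lookup_single when_def)
  then show "mdegree m \<le> mdegree (Poly_Mapping.single (4::4) k)" by (simp add: mdegree_4 exps4_def lookup_single)
qed

text \<open>
  For the forward direction, multiply \<open>x\<^sub>4 ^ a24\<close> by \<open>x\<^sub>1\<close> repeatedly: the product with \<open>x\<^sub>1 ^ a21\<close> has maximal
  degree, so its degree is at least that of \<open>x\<^sub>2 ^ (a32 + a42)\<close>, which has the same weight.
\<close>

theorem cm_tangent_cone_iff_a2:
  "cm_tangent_cone TYPE('k) n \<longleftrightarrow> a32 + a42 \<le> a21 + a24"
proof -
  interpret least_weight n 1 by (rule least_weight_1)
  have "a32 + a42 \<le> a21 + a24"
    if step: "\<And>m. maximal_degree n m \<Longrightarrow> maximal_degree n (Poly_Mapping.single 1 1 + m)"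
  proof -
    have max: "maximal_degree n (Poly_Mapping.single 1 k + Poly_Mapping.single 4 a24)" for k
    proof (induction k)
      case 0
      then show ?case using maximal_degree_x4_power[of a24] exp_pos by simp
    next
      case (Suc k)
      have "Poly_Mapping.single 1 (Suc k) + Poly_Mapping.single 4 a24
          = Poly_Mapping.single 1 1 + (Poly_Mapping.single (1::4) k + Poly_Mapping.single 4 a24)"
        by (simp add: add.assoc[symmetric] flip: single_add)
      then show ?case using step[OF Suc] by simp
    qed
    have "weight n (Poly_Mapping.single 2 (a32 + a42)) =
        weight n (Poly_Mapping.single 1 a21 + Poly_Mapping.single 4 a24)"
      using weight_relations(2) by simp
    then have "mdegree (Poly_Mapping.single (2::4) (a32 + a42)) \<le>
        mdegree (Poly_Mapping.single 1 a21 + Poly_Mapping.single (4::4) a24)"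
      by (rule max[of a21, unfolded maximal_degree_def, rule_format])
    then show ?thesis by simp
  qed
  then show ?thesis unfolding cm_tangent_cone_iff using maximal_degree_Suc by blast
qed

end

theorem theorem3p7:
  fixes n :: "4 \<Rightarrow> nat"
    and a\<^sub>1 a\<^sub>2 a\<^sub>3 a\<^sub>4 a\<^sub>1\<^sub>3 a\<^sub>1\<^sub>4 a\<^sub>2\<^sub>1 a\<^sub>2\<^sub>4 a\<^sub>3\<^sub>1 a\<^sub>3\<^sub>2 a\<^sub>4\<^sub>2 a\<^sub>4\<^sub>3 :: nat
  assumes "0 < n 1" and "n 1 < n 2" and "n 2 < n 3" and "n 3 < n 4"
    and "Gcd (range n) = 1"
    and "\<not> complete_intersection ring_of_type_algebra (curve_ideal n :: (4, 'k::field) mpoly set)"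
    and "gorenstein_curve n"
    and "0 < a\<^sub>2\<^sub>1" "a\<^sub>2\<^sub>1 < a\<^sub>1" "0 < a\<^sub>3\<^sub>1" "a\<^sub>3\<^sub>1 < a\<^sub>1"
    and "0 < a\<^sub>3\<^sub>2" "a\<^sub>3\<^sub>2 < a\<^sub>2" "0 < a\<^sub>4\<^sub>2" "a\<^sub>4\<^sub>2 < a\<^sub>2"
    and "0 < a\<^sub>1\<^sub>3" "a\<^sub>1\<^sub>3 < a\<^sub>3" "0 < a\<^sub>4\<^sub>3" "a\<^sub>4\<^sub>3 < a\<^sub>3"
    and "0 < a\<^sub>1\<^sub>4" "a\<^sub>1\<^sub>4 < a\<^sub>4" "0 < a\<^sub>2\<^sub>4" "a\<^sub>2\<^sub>4 < a\<^sub>4"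
    and "a\<^sub>1 = a\<^sub>2\<^sub>1 + a\<^sub>3\<^sub>1" and "a\<^sub>2 = a\<^sub>3\<^sub>2 + a\<^sub>4\<^sub>2"
    and "a\<^sub>3 = a\<^sub>1\<^sub>3 + a\<^sub>4\<^sub>3" and "a\<^sub>4 = a\<^sub>1\<^sub>4 + a\<^sub>2\<^sub>4"
    and "minimally_generates ring_of_type_algebra
      {Var 1 ^ a\<^sub>1 - Var 3 ^ a\<^sub>1\<^sub>3 * Var 4 ^ a\<^sub>1\<^sub>4,
       Var 2 ^ a\<^sub>2 - Var 1 ^ a\<^sub>2\<^sub>1 * Var 4 ^ a\<^sub>2\<^sub>4,
       Var 3 ^ a\<^sub>3 - Var 1 ^ a\<^sub>3\<^sub>1 * Var 2 ^ a\<^sub>3\<^sub>2,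
       Var 4 ^ a\<^sub>4 - Var 2 ^ a\<^sub>4\<^sub>2 * Var 3 ^ a\<^sub>4\<^sub>3,
       Var 1 ^ a\<^sub>2\<^sub>1 * Var 3 ^ a\<^sub>4\<^sub>3 - Var 2 ^ a\<^sub>3\<^sub>2 * Var 4 ^ a\<^sub>1\<^sub>4}
      (curve_ideal n :: (4, 'k) mpoly set)"
  shows "cm_tangent_cone TYPE('k) n \<longleftrightarrow> a\<^sub>2 \<le> a\<^sub>2\<^sub>1 + a\<^sub>2\<^sub>4"
proof -
  interpret bresinsky_curve n a\<^sub>1\<^sub>3 a\<^sub>1\<^sub>4 a\<^sub>2\<^sub>1 a\<^sub>2\<^sub>4 a\<^sub>3\<^sub>1 a\<^sub>3\<^sub>2 a\<^sub>4\<^sub>2 a\<^sub>4\<^sub>3 "TYPE('k)"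
    using assms by unfold_locales (simp_all add: minimally_generates_def bresinsky_generators_def)
  show ?thesis using cm_tangent_cone_iff_a2 assms by simp
qed

end
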